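(* Let $\Sigma$ be a pointed algebraic monad on the category $\mathrm{Sets}_*$ of pointed sets, with product $\mu:\Sigma\circ\Sigma\to\Sigma$. Then the restriction $\mathcal A$ of $\Sigma$ to $\Gamma^{\rm op}\subset \mathrm{Fin}_*\subset \mathrm{Sets}_*$ defines an $\mathbb S$-algebra, with the product $m=\mu\circ\alpha_{\Sigma,\mathcal A}:\mathcal A\wedge\mathcal A\to\mathcal A$ defined as the composite of the assembly map $\alpha_{\Sigma,\mathcal A}:\mathcal A\wedge\mathcal A\to\Sigma\circ\mathcal A$ and the product $\mu$ of the monad $\Sigma$.
   Context: For $k\ge 0$ let $k_+=\{0,1,\dots,k\}$, pointed by $0$. $\Gamma^{\rm op}$ is the full subcategory of the category $\mathrm{Fin}_*$ of finite pointed sets on the objects $k_+$ (functors on $\Gamma^{\rm op}$ are evaluated on arbitrary finite pointed sets via the equivalence $\Gamma^{\rm op}\simeq\mathrm{Fin}_*$). A $\Gamma$-set is a functor $F:\Gamma^{\rm op}\to\mathrm{Sets}_*$ with $F(0_+)$ a one-point set; morphisms are natural transformations. The smash product $X\wedge Y$ of pointed sets is $X\times Y$ with $X\times\{*\}\cup\{*\}\times Y$ collapsed to the base point. The smash product of $\Gamma$-sets is the Day convolution $(F_1\wedge F_2)(Z)=\varinjlim_{v:X\wedge Y\to Z}F_1(X)\wedge F_2(Y)$; a morphism $F_1\wedge F_2\to G$ is the same as a family of pointed maps $F_1(X)\wedge F_2(Y)\to G(X\wedge Y)$ natural in $X,Y$. Let $\mathbb S:\Gamma^{\rm op}\to\mathrm{Sets}_*$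 be the inclusion functor; it is the unit for $\wedge$. An $\mathbb S$-algebra is a $\Gamma$-set $\mathcal A$ with an associative multiplication $\mathcal A\wedge\mathcal A\to\mathcal A$ and a unit $\mathbb S\to\mathcal A$ (a monoid in $(\Gamma\text{-sets},\wedge,\mathbb S)$). A monad on $\mathrm{Sets}_*$ is an endofunctor $\Sigma$ with natural transformations $\mu:\Sigma\circ\Sigma\to\Sigma$ and $\epsilon:\mathrm{Id}\to\Sigma$ satisfying the usual associativity and unit axioms. It is pointed if the endofunctor preserves the one-point set, and algebraic if the endofunctor preserves filtered colimits. A $\Gamma$-set $M$ extends to a pointed endofunctor $\tilde M$ of $\mathrm{Sets}_*$ by $\tilde M(X)=\varinjlim_{Y\subset X}M(Y)$, over finite pointed subsets $Y\subset X$; if $\mathcal A$ is the restriction of an algebraic $\Sigma$, then $\tilde{\mathcal A}=\Sigma$. Assembly map: for a $\Gamma$-set $N$ and pointed sets $X,Y$, let $\iota^N_{X,Y}:X\wedge\tilde N(Y)\to\tilde N(X\wedge Y)$ be given on $\{x\}\times \tilde N(Y)$ by $\tilde N(\delta_x)$, where $\delta_x:Y\to X\wedge Y$, $\delta_x(y)=(x,y)$. For $\Gamma$-sets $M,N$, the maps $\alpha_{X,Y}:\tilde M(X)\wedge\tilde N(Y)\to\tilde M(\tilde N(X\wedge Y))$ are the composites of $\tilde M(X)\wedge\tilde N(Y)\to\tilde M(X\wedge\tilde N(Y))$ (the map $\iota^M_{\tilde N(Y),X}$, up to exchanging the smash factors) with $\tilde M(\iota^N_{X,Y})$. Restricted to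 finite pointed $X,Y$, these define a morphism of $\Gamma$-sets $\alpha_{M,N}:M\wedge N\to\tilde M\circ N$, the assembly map. $\alpha_{\Sigma,\mathcal A}$ denotes this map for $M=N=\mathcal A$, $\tilde M=\Sigma$. *)

theory Defs
  imports Main "HOL-Library.FuncSet"
begin

section \<open>Categories, functors, monads\<close>

text \<open>\<open>Cmp C X Y Z g f\<close> is \<open>g \<circ> f\<close> for \<open>f : X \<rightarrow> Y\<close>, \<open>g : Y \<rightarrow> Z\<close>. Hom-sets need not be disjoint,
  so composition and the action of a functor on morphisms take the objects as arguments.\<close>

record ('o, 'm) cat =
  Ob  :: "'o set"
  Hom :: "'o \<Rightarrow> 'o \<Rightarrow> 'm set"
  Idt :: "'o \<Rightarrow> 'm"
  Cmp :: "'o \<Rightarrow> 'o \<Rightarrow> 'o \<Rightarrow> 'm \<Rightarrow> 'm \<Rightarrow> 'm"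

locale category =
  fixes C :: "('o, 'm) cat"
  assumes idt: "X \<in> Ob C \<Longrightarrow> Idt C X \<in> Hom C X X"
    and cmp: "\<lbrakk>X \<in> Ob C; Y \<in> Ob C; Z \<in> Ob C; f \<in> Hom C X Y; g \<in> Hom C Y Z\<rbrakk>
      \<Longrightarrow> Cmp C X Y Z g f \<in> Hom C X Z"
    and idt_left: "\<lbrakk>X \<in> Ob C; Y \<in> Ob C; f \<in> Hom C X Y\<rbrakk> \<Longrightarrow> Cmp C X Y Y (Idt C Y) f = f"
    and idt_right: "\<lbrakk>X \<in> Ob C; Y \<in> Ob C; f \<in> Hom C X Y\<rbrakk> \<Longrightarrow> Cmp C X X Y f (Idt C X) = f"
    and cmp_assoc: "\<lbrakk>W \<in> Ob C; X \<in> Ob C; Y \<in> Ob C; Z \<in> Ob C;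
        f \<in> Hom C W X; g \<in> Hom C X Y; h \<in> Hom C Y Z\<rbrakk>
      \<Longrightarrow> Cmp C W Y Z h (Cmp C W X Y g f) = Cmp C W X Z (Cmp C X Y Z h g) f"

record ('o, 'm, 'p, 'q) funct =
  obj :: "'o \<Rightarrow> 'p"
  mor :: "'o \<Rightarrow> 'o \<Rightarrow> 'm \<Rightarrow> 'q"

locale is_functor =
  fixes C :: "('o, 'm) cat" and D :: "('p, 'q) cat" and F :: "('o, 'm, 'p, 'q) funct"
  assumes obj_in: "X \<in> Ob C \<Longrightarrow> obj F X \<in> Ob D"
    and mor_in: "\<lbrakk>X \<in> Ob C; Y \<in> Ob C; f \<in> Hom C X Y\<rbrakk> \<Longrightarrow> mor F X Y f \<in> Hom D (obj F X) (obj F Y)"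
    and mor_idt: "X \<in> Ob C \<Longrightarrow> mor F X X (Idt C X) = Idt D (obj F X)"
    and mor_cmp: "\<lbrakk>X \<in> Ob C; Y \<in> Ob C; Z \<in> Ob C; f \<in> Hom C X Y; g \<in> Hom C Y Z\<rbrakk>
      \<Longrightarrow> mor F X Z (Cmp C X Y Z g f)
        = Cmp D (obj F X) (obj F Y) (obj F Z) (mor F Y Z g) (mor F X Y f)"

definition id_funct :: "('o, 'm, 'o, 'm) funct" where
  "id_funct = \<lparr>obj = (\<lambda>X. X), mor = (\<lambda>X Y f. f)\<rparr>"

definition comp_funct ::
  "('p, 'q, 'r, 's) funct \<Rightarrow> ('o, 'm, 'p, 'q) funct \<Rightarrow> ('o, 'm, 'r, 's) funct"  (infixr "\<circ>\<^sub>F" 55) where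
  "G \<circ>\<^sub>F F = \<lparr>obj = (\<lambda>X. obj G (obj F X)),
             mor = (\<lambda>X Y f. mor G (obj F X) (obj F Y) (mor F X Y f))\<rparr>"

locale nat_trans =
  fixes C :: "('o, 'm) cat" and D :: "('p, 'q) cat"
    and F G :: "('o, 'm, 'p, 'q) funct" and \<eta> :: "'o \<Rightarrow> 'q"
  assumes component: "X \<in> Ob C \<Longrightarrow> \<eta> X \<in> Hom D (obj F X) (obj G X)"
    and naturality: "\<lbrakk>X \<in> Ob C; Y \<in> Ob C; f \<in> Hom C X Y\<rbrakk>
      \<Longrightarrow> Cmp D (obj F X) (obj F Y) (obj G Y) (\<eta> Y) (mor F X Y f)
        = Cmp D (obj F X) (obj G X) (obj G Y) (mor G X Y f) (\<eta> X)"

locale monad =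
  fixes C :: "('o, 'm) cat" and T :: "('o, 'm, 'o, 'm) funct" and \<mu> \<epsilon> :: "'o \<Rightarrow> 'm"
  assumes endofunctor: "is_functor C C T"
    and mult: "nat_trans C C (T \<circ>\<^sub>F T) T \<mu>"
    and unit: "nat_trans C C id_funct T \<epsilon>"
    and assoc: "X \<in> Ob C \<Longrightarrow>
        Cmp C (obj T (obj T (obj T X))) (obj T (obj T X)) (obj T X)
          (\<mu> X) (mor T (obj T (obj T X)) (obj T X) (\<mu> X))
      = Cmp C (obj T (obj T (obj T X))) (obj T (obj T X)) (obj T X)
          (\<mu> X) (\<mu> (obj T X))"
    and unit_left: "X \<in> Ob C \<Longrightarrow>
        Cmp C (obj T X) (obj T (obj T X)) (obj T X) (\<mu> X) (\<epsilon> (obj T X)) = Idt C (obj T X)"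
    and unit_right: "X \<in> Ob C \<Longrightarrow>
        Cmp C (obj T X) (obj T (obj T X)) (obj T X) (\<mu> X) (mor T X (obj T X) (\<epsilon> X))
      = Idt C (obj T X)"

definition is_cocone ::
  "('p, 'q) cat \<Rightarrow> ('o, 'm) cat \<Rightarrow> ('o, 'm, 'p, 'q) funct \<Rightarrow> 'p \<Rightarrow> ('o \<Rightarrow> 'q) \<Rightarrow> bool" where
  "is_cocone C J D L c \<longleftrightarrow> L \<in> Ob C \<and> (\<forall>i\<in>Ob J. c i \<in> Hom C (obj D i) L) \<and>
     (\<forall>i\<in>Ob J. \<forall>j\<in>Ob J. \<forall>f\<in>Hom J i j. Cmp C (obj D i) (obj D j) L (c j) (mor D i j f) = c i)"

definition is_colimit ::
  "('p, 'q) cat \<Rightarrow> ('o, 'm) cat \<Rightarrow> ('o, 'm, 'p, 'q) funct \<Rightarrow> 'p \<Rightarrow> ('o \<Rightarrow> 'q) \<Rightarrow> bool" where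
  "is_colimit C J D L c \<longleftrightarrow> is_cocone C J D L c \<and>
     (\<forall>L' c'. is_cocone C J D L' c' \<longrightarrow>
        (\<exists>!h. h \<in> Hom C L L' \<and> (\<forall>i\<in>Ob J. Cmp C (obj D i) L L' h (c i) = c' i)))"

definition filtered :: "('o, 'm) cat \<Rightarrow> bool" where
  "filtered J \<longleftrightarrow> Ob J \<noteq> {} \<and>
     (\<forall>i\<in>Ob J. \<forall>j\<in>Ob J. \<exists>k\<in>Ob J. Hom J i k \<noteq> {} \<and> Hom J j k \<noteq> {}) \<and>
     (\<forall>i\<in>Ob J. \<forall>j\<in>Ob J. \<forall>f\<in>Hom J i j. \<forall>g\<in>Hom J i j.
        \<exists>k\<in>Ob J. \<exists>h\<in>Hom J j k. Cmp J i j k h f = Cmp J i j k h g)"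


section \<open>Pointed sets\<close>

text \<open>A morphism is a base point preserving function that is \<open>undefined\<close> outside its domain, so that
  equality of morphisms is equality in HOL.\<close>

record 'a pset =
  car :: "'a set"
  pt  :: "'a"

definition pmaps :: "'a pset \<Rightarrow> 'b pset \<Rightarrow> ('a \<Rightarrow> 'b) set" where
  "pmaps X Y = {f \<in> car X \<rightarrow>\<^sub>E car Y. f (pt X) = pt Y}"

definition Sets_pt :: "('a set \<Rightarrow> bool) \<Rightarrow> ('a pset, 'a \<Rightarrow> 'a) cat" where
  "Sets_pt small =
     \<lparr>Ob = {X. pt X \<in> car X \<and> small (car X)},
      Hom = pmaps,
      Idt = (\<lambda>X. \<lambda>x\<in>car X. x),
      Cmp = (\<lambda>X Y Z g f. compose (car X) g f)\<rparr>"

text \<open>HOL has no type of all sets. The category of (pointed) sets is therefore the category of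
  (pointed) small subsets of a type \<open>'u\<close>, for an arbitrary notion of smallness with the closure
  properties below, which hold for the sets of a Grothendieck universe with an infinite member (and
  also when all subsets of an infinite type are declared small). The last axiom provides a small
  set indexing the finite subsets of a small set. The maps \<open>num\<close> and \<open>pair\<close> are an arbitrary
  encoding of numbers and of ordered pairs as elements of \<open>'u\<close>.\<close>

locale set_universe =
  fixes small :: "'u set \<Rightarrow> bool" and num :: "nat \<Rightarrow> 'u" and pair :: "'u \<times> 'u \<Rightarrow> 'u"
  assumes inj_num: "inj num"
    and inj_pair: "inj pair"
    and small_finite: "finite A \<Longrightarrow> small A"
    and small_subset: "\<lbrakk>small B; A \<subseteq> B\<rbrakk> \<Longrightarrow> small A"
    and small_image: "small A \<Longrightarrow> small (f ` A)"
    and small_UN: "\<lbrakk>small I; \<And>i. i \<in> I \<Longrightarrow> small (E i)\<rbrakk> \<Longrightarrow> small (\<Union>i\<in>I. E i)"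
    and small_Fpow: "small A \<Longrightarrow> \<exists>e. inj_on e (Fpow A) \<and> small (e ` Fpow A)"

definition pointed_funct :: "('u set \<Rightarrow> bool) \<Rightarrow> ('u pset, 'u \<Rightarrow> 'u, 'u pset, 'u \<Rightarrow> 'u) funct \<Rightarrow> bool" where
  "pointed_funct small T \<longleftrightarrow>
     (\<forall>X \<in> Ob (Sets_pt small). car X = {pt X} \<longrightarrow> car (obj T X) = {pt (obj T X)})"

text \<open>Preservation of filtered colimits: for every diagram indexed by a small filtered category,
  every colimit cocone is mapped to a colimit cocone.\<close>

definition algebraic :: "('u set \<Rightarrow> bool) \<Rightarrow> ('u pset, 'u \<Rightarrow> 'u, 'u pset, 'u \<Rightarrow> 'u) funct \<Rightarrow> bool" where
  "algebraic small T \<longleftrightarrow>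
     (\<forall>(J :: ('u, 'u) cat) D L c.
        category J \<and> small (Ob J) \<and> small (\<Union>i\<in>Ob J. \<Union>j\<in>Ob J. Hom J i j) \<and> filtered J \<and>
        is_functor J (Sets_pt small) D \<and> is_colimit (Sets_pt small) J D L c \<longrightarrow>
        is_colimit (Sets_pt small) J (T \<circ>\<^sub>F D) (obj T L) (\<lambda>i. mor T (obj D i) L (c i)))"

text \<open>The smash product, with the class of \<open>(x, y)\<close> represented by \<open>(x, y)\<close> itself if neither
  coordinate is the base point and by the pair of base points otherwise. Ordered pairs are encoded by
  \<open>p\<close>: either \<open>\<lambda>z. z\<close>, or the map \<open>pair\<close> of the locale \<open>set_universe\<close>.\<close>

definition smash_el :: "('a \<times> 'b \<Rightarrow> 'c) \<Rightarrow> 'a pset \<Rightarrow> 'b pset \<Rightarrow> 'a \<Rightarrow> 'b \<Rightarrow> 'c" where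
  "smash_el p X Y x y = (if x = pt X \<or> y = pt Y then p (pt X, pt Y) else p (x, y))"

definition smash :: "('a \<times> 'b \<Rightarrow> 'c) \<Rightarrow> 'a pset \<Rightarrow> 'b pset \<Rightarrow> 'c pset" where
  "smash p X Y = \<lparr>car = {smash_el p X Y x y |x y. x \<in> car X \<and> y \<in> car Y}, pt = p (pt X, pt Y)\<rparr>"

text \<open>The map \<open>h\<close> on \<open>X \<times> Y\<close>, seen as a map on \<open>X \<and> Y\<close>.\<close>

definition smash_fun :: "('a \<times> 'b \<Rightarrow> 'c) \<Rightarrow> 'a pset \<Rightarrow> 'b pset \<Rightarrow> ('a \<Rightarrow> 'b \<Rightarrow> 'd) \<Rightarrow> 'c \<Rightarrow> 'd" where
  "smash_fun p X Y h = (\<lambda>z \<in> car (smash p X Y). case_prod h (inv p z))"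

abbreviation psmash :: "'a pset \<Rightarrow> 'b pset \<Rightarrow> ('a \<times> 'b) pset"  (infixr "\<and>\<^sub>*" 70) where
  "X \<and>\<^sub>* Y \<equiv> smash (\<lambda>z. z) X Y"

definition smash_map ::
  "'a pset \<Rightarrow> 'b pset \<Rightarrow> 'c pset \<Rightarrow> 'd pset \<Rightarrow> ('a \<Rightarrow> 'c) \<Rightarrow> ('b \<Rightarrow> 'd) \<Rightarrow> 'a \<times> 'b \<Rightarrow> 'c \<times> 'd" where
  "smash_map X Y X' Y' f g = smash_fun (\<lambda>z. z) X Y (\<lambda>x y. smash_el (\<lambda>z. z) X' Y' (f x) (g y))"

text \<open>The colimit of a diagram of pointed sets over a nonempty category: the disjoint union modulo
  the equivalence relation generated by the morphisms and the identification of all base points.\<close>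

definition colim_gen :: "('o, 'm) cat \<Rightarrow> ('o, 'm, 'a pset, 'a \<Rightarrow> 'a) funct \<Rightarrow> ('o \<times> 'a) rel" where
  "colim_gen J D =
     {((i, x), (j, mor D i j f x)) |i j f x. i \<in> Ob J \<and> j \<in> Ob J \<and> f \<in> Hom J i j \<and> x \<in> car (obj D i)} \<union>
     {((i, pt (obj D i)), (j, pt (obj D j))) |i j. i \<in> Ob J \<and> j \<in> Ob J}"

definition colim_cls ::
  "('o, 'm) cat \<Rightarrow> ('o, 'm, 'a pset, 'a \<Rightarrow> 'a) funct \<Rightarrow> 'o \<Rightarrow> 'a \<Rightarrow> ('o \<times> 'a) set" where
  "colim_cls J D i x = (colim_gen J D \<union> (colim_gen J D)\<inverse>)\<^sup>* `` {(i, x)}"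

definition colim ::
  "('o, 'm) cat \<Rightarrow> ('o, 'm, 'a pset, 'a \<Rightarrow> 'a) funct \<Rightarrow> ('o \<times> 'a) set pset" where
  "colim J D = \<lparr>car = {colim_cls J D i x |i x. i \<in> Ob J \<and> x \<in> car (obj D i)},
                pt = (\<Union>i\<in>Ob J. colim_cls J D i (pt (obj D i)))\<rparr>"

text \<open>The map on the colimit given by the cocone \<open>c\<close>.\<close>

definition colim_desc ::
  "('o, 'm) cat \<Rightarrow> ('o, 'm, 'a pset, 'a \<Rightarrow> 'a) funct \<Rightarrow> ('o \<Rightarrow> 'a \<Rightarrow> 'b) \<Rightarrow> ('o \<times> 'a) set \<Rightarrow> 'b" where
  "colim_desc J D c = (\<lambda>q \<in> car (colim J D). the_elem ((\<lambda>(i, x). c i x) ` q))"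

lemma colim_desc_cls:
  assumes "i \<in> Ob J" "x \<in> car (obj D i)"
    and comm: "\<And>i j f x. \<lbrakk>i \<in> Ob J; j \<in> Ob J; f \<in> Hom J i j; x \<in> car (obj D i)\<rbrakk>
      \<Longrightarrow> c j (mor D i j f x) = c i x"
    and base: "\<And>i. i \<in> Ob J \<Longrightarrow> c i (pt (obj D i)) = b"
  shows "colim_desc J D c (colim_cls J D i x) = c i x"
proof -
  let ?r = "colim_gen J D \<union> (colim_gen J D)\<inverse>"
  let ?c = "\<lambda>(i, x). c i x"
  have gen: "?c z = ?c w" if "(z, w) \<in> colim_gen J D" for z w
    using that unfolding colim_gen_def
  proof
    assume "(z, w) \<in> {((i, x), (j, mor D i j f x)) |i j f x.
      i \<in> Ob J \<and> j \<in> Ob J \<and> f \<in> Hom J i j \<and> x \<in> car (obj D i)}"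
    then show ?thesis using comm by auto
  next
    assume "(z, w) \<in> {((i, pt (obj D i)), (j, pt (obj D j))) |i j. i \<in> Ob J \<and> j \<in> Ob J}"
    then show ?thesis using base by auto
  qed
  have step: "?c z = ?c w" if "(z, w) \<in> ?r" for z w
    using that gen[of z w] gen[of w z] by (metis UnE converseD)
  have "?c w = c i x" if "w \<in> colim_cls J D i x" for w
  proof -
    from that have "((i, x), w) \<in> ?r\<^sup>*" by (simp add: colim_cls_def)
    then have "?c w = ?c (i, x)"
      by (induction rule: rtrancl_induct) (use step in metis)+
    then show ?thesis by simp
  qed
  moreover have "(i, x) \<in> colim_cls J D i x" by (simp add: colim_cls_def)
  ultimately have "?c ` colim_cls J D i x = {c i x}" by blast
  moreover have "colim_cls J D i x \<in> car (colim J D)"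
    using assms(1,2) by (auto simp: colim_def)
  ultimately show ?thesis by (simp add: colim_desc_def)
qed


section \<open>\<open>\<Gamma>\<close>-sets\<close>

definition std :: "nat \<Rightarrow> nat pset" where
  "std k = \<lparr>car = {0..k}, pt = 0\<rparr>"

definition Gamma_op :: "(nat, nat \<Rightarrow> nat) cat" where
  "Gamma_op =
     \<lparr>Ob = UNIV,
      Hom = (\<lambda>k l. pmaps (std k) (std l)),
      Idt = (\<lambda>k. \<lambda>i\<in>{0..k}. i),
      Cmp = (\<lambda>k l m g f. compose {0..k} g f)\<rparr>"

type_synonym 'a gfunct = "(nat, nat \<Rightarrow> nat, 'a pset, 'a \<Rightarrow> 'a) funct"

definition Gamma_set :: "'a gfunct \<Rightarrow> bool" where
  "Gamma_set F \<longleftrightarrow> is_functor Gamma_op (Sets_pt (\<lambda>_. True)) F \<and> car (obj F 0) = {pt (obj F 0)}"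

text \<open>Domain and codomain may take values in different types, so this is naturality in the sense of
  \<open>nat_trans\<close> spelled out for pointed sets.\<close>

definition Gamma_hom :: "'a gfunct \<Rightarrow> 'b gfunct \<Rightarrow> (nat \<Rightarrow> 'a \<Rightarrow> 'b) \<Rightarrow> bool" where
  "Gamma_hom F G \<eta> \<longleftrightarrow>
     (\<forall>k. \<eta> k \<in> pmaps (obj F k) (obj G k)) \<and>
     (\<forall>k l. \<forall>f \<in> pmaps (std k) (std l).
        compose (car (obj F k)) (\<eta> l) (mor F k l f) = compose (car (obj F k)) (mor G k l f) (\<eta> k))"

definition Gamma_id :: "'a gfunct \<Rightarrow> nat \<Rightarrow> 'a \<Rightarrow> 'a" where
  "Gamma_id F k = (\<lambda>x \<in> car (obj F k). x)"

definition Gamma_comp ::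
  "'a gfunct \<Rightarrow> (nat \<Rightarrow> 'b \<Rightarrow> 'c) \<Rightarrow> (nat \<Rightarrow> 'a \<Rightarrow> 'b) \<Rightarrow> nat \<Rightarrow> 'a \<Rightarrow> 'c" where
  "Gamma_comp F \<psi> \<phi> k = compose (car (obj F k)) (\<psi> k) (\<phi> k)"

text \<open>The inclusion functor.\<close>

definition \<S> :: "nat gfunct" where
  "\<S> = \<lparr>obj = std, mor = (\<lambda>k l f. f)\<rparr>"

text \<open>In the skeleton, \<open>k\<^sub>+ \<and> l\<^sub>+\<close> is identified with \<open>(k * l)\<^sub>+\<close> by the lexicographic numbering
  \<open>nsm l\<close> of the pairs \<open>(i, j)\<close> with \<open>1 \<le> i \<le> k\<close>, \<open>1 \<le> j \<le> l\<close>. For this choice the associativity and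
  unit isomorphisms of the smash product on \<open>\<Gamma>\<close>op are identities (see \<open>nsm_assoc\<close>).\<close>

definition nsm :: "nat \<Rightarrow> nat \<Rightarrow> nat \<Rightarrow> nat" where
  "nsm l i j = (if i = 0 \<or> j = 0 then 0 else (i - 1) * l + j)"

text \<open>\<open>f \<and> g : (k * l)\<^sub>+ \<rightarrow> (k' * l')\<^sub>+\<close> for \<open>f : k\<^sub>+ \<rightarrow> k'\<^sub>+\<close>, \<open>g : l\<^sub>+ \<rightarrow> l'\<^sub>+\<close>
  (see \<open>nsmash_nsm\<close>).\<close>

definition nsmash :: "nat \<Rightarrow> nat \<Rightarrow> nat \<Rightarrow> (nat \<Rightarrow> nat) \<Rightarrow> (nat \<Rightarrow> nat) \<Rightarrow> nat \<Rightarrow> nat" where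
  "nsmash k l l' f g = (\<lambda>n\<in>{0..k * l}. if n = 0 then 0
     else nsm l' (f ((n - 1) div l + 1)) (g ((n - 1) mod l + 1)))"

lemma nsm_le: "\<lbrakk>i \<le> k; j \<le> l\<rbrakk> \<Longrightarrow> nsm l i j \<le> k * l"
proof -
  assume ij: "i \<le> k" "j \<le> l"
  show ?thesis
  proof (cases "i = 0 \<or> j = 0")
    case False
    then have "nsm l i j \<le> (i - 1) * l + l" using ij by (simp add: nsm_def)
    also have "\<dots> = i * l" using False by (cases i) auto
    also have "\<dots> \<le> k * l" using ij by simp
    finally show ?thesis .
  qed (auto simp: nsm_def)
qed

lemma nsm_assoc: "nsm n (nsm m i j) k = nsm (m * n) i (nsm n j k)"
  by (cases i; cases j; cases k) (auto simp: nsm_def algebra_simps)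

lemma nsmash_nsm:
  assumes "f \<in> pmaps (std k) (std k')" "g \<in> pmaps (std l) (std l')" "i \<le> k" "j \<le> l"
  shows "nsmash k l l' f g (nsm l i j) = nsm l' (f i) (g j)"
proof (cases "i = 0 \<or> j = 0")
  case True
  with assms show ?thesis by (auto simp: nsmash_def nsm_def pmaps_def std_def)
next
  case False
  then obtain i' j' where ij: "i = Suc i'" "j = Suc j'" by (meson not0_implies_Suc)
  with assms have j': "j' < l" by simp
  have "(i' * l + j') div l = i'" "(i' * l + j') mod l = j'" using j' by auto
  then show ?thesis using nsm_le[OF assms(3,4)] ij by (simp add: nsmash_def nsm_def)
qed

text \<open>Day convolution. The objects over \<open>Z\<close> are triples \<open>(k, l, v)\<close> with \<open>v : k\<^sub>+ \<and> l\<^sub>+ \<rightarrow> Z\<^sub>+\<close>.\<close>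

type_synonym day_ob = "nat \<times> nat \<times> (nat \<Rightarrow> nat)"
type_synonym day_mor = "(nat \<Rightarrow> nat) \<times> (nat \<Rightarrow> nat)"

definition day_idx :: "nat \<Rightarrow> (day_ob, day_mor) cat" where
  "day_idx Z =
     \<lparr>Ob = {(k, l, v). v \<in> pmaps (std (k * l)) (std Z)},
      Hom = (\<lambda>(k, l, v) (k', l', v').
        {(f, g). f \<in> pmaps (std k) (std k') \<and> g \<in> pmaps (std l) (std l') \<and>
                 compose {0..k * l} v' (nsmash k l l' f g) = v}),
      Idt = (\<lambda>(k, l, v). (\<lambda>i\<in>{0..k}. i, \<lambda>j\<in>{0..l}. j)),
      Cmp = (\<lambda>(k, l, v) _ _ (f', g') (f, g). (compose {0..k} f' f, compose {0..l} g' g))\<rparr>"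

definition day_diag ::
  "'a gfunct \<Rightarrow> 'b gfunct \<Rightarrow> (day_ob, day_mor, ('a \<times> 'b) pset, 'a \<times> 'b \<Rightarrow> 'a \<times> 'b) funct" where
  "day_diag F G =
     \<lparr>obj = (\<lambda>(k, l, v). obj F k \<and>\<^sub>* obj G l),
      mor = (\<lambda>(k, l, v) (k', l', v') (f, g).
        smash_map (obj F k) (obj G l) (obj F k') (obj G l') (mor F k k' f) (mor G l l' g))\<rparr>"

text \<open>The class of \<open>z \<in> F(k\<^sub>+) \<and> G(l\<^sub>+)\<close> at \<open>v : k\<^sub>+ \<and> l\<^sub>+ \<rightarrow> Z\<^sub>+\<close>.\<close>

abbreviation day_cls ::
  "'a gfunct \<Rightarrow> 'b gfunct \<Rightarrow> nat \<Rightarrow> nat \<Rightarrow> nat \<Rightarrow> (nat \<Rightarrow> nat) \<Rightarrow> 'a \<times> 'b \<Rightarrow> (day_ob \<times> 'a \<times> 'b) set" where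
  "day_cls F G Z k l v z \<equiv> colim_cls (day_idx Z) (day_diag F G) (k, l, v) z"

abbreviation day_desc ::
  "'a gfunct \<Rightarrow> 'b gfunct \<Rightarrow> nat \<Rightarrow> (nat \<Rightarrow> nat \<Rightarrow> (nat \<Rightarrow> nat) \<Rightarrow> 'a \<times> 'b \<Rightarrow> 'c) \<Rightarrow>
    (day_ob \<times> 'a \<times> 'b) set \<Rightarrow> 'c" where
  "day_desc F G Z c \<equiv> colim_desc (day_idx Z) (day_diag F G) (\<lambda>(k, l, v). c k l v)"

definition day :: "'a gfunct \<Rightarrow> 'b gfunct \<Rightarrow> (day_ob \<times> 'a \<times> 'b) set gfunct"  (infixr "\<and>\<^sub>\<Gamma>" 70) where
  "F \<and>\<^sub>\<Gamma> G =
     \<lparr>obj = (\<lambda>Z. colim (day_idx Z) (day_diag F G)),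
      mor = (\<lambda>Z Z' w. day_desc F G Z (\<lambda>k l v. day_cls F G Z' k l (compose {0..k * l} w v)))\<rparr>"

text \<open>The functoriality of \<open>\<and>\<^sub>\<Gamma>\<close> on morphisms \<open>\<phi> : F \<rightarrow> F'\<close>, \<open>\<psi> : G \<rightarrow> G'\<close>.\<close>

definition day_map ::
  "'a gfunct \<Rightarrow> 'b gfunct \<Rightarrow> 'c gfunct \<Rightarrow> 'd gfunct \<Rightarrow> (nat \<Rightarrow> 'a \<Rightarrow> 'c) \<Rightarrow> (nat \<Rightarrow> 'b \<Rightarrow> 'd) \<Rightarrow>
    nat \<Rightarrow> (day_ob \<times> 'a \<times> 'b) set \<Rightarrow> (day_ob \<times> 'c \<times> 'd) set" where
  "day_map F G F' G' \<phi> \<psi> Z = day_desc F G Z (\<lambda>k l v z. day_cls F' G' Z k l v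
     (smash_map (obj F k) (obj G l) (obj F' k) (obj G' l) (\<phi> k) (\<psi> l) z))"

text \<open>The morphism \<open>F \<and> G \<rightarrow> H\<close> given by a natural family \<open>\<phi> k l : F(k\<^sub>+) \<and> G(l\<^sub>+) \<rightarrow> H(k\<^sub>+ \<and> l\<^sub>+)\<close>.\<close>

definition day_lift ::
  "'a gfunct \<Rightarrow> 'b gfunct \<Rightarrow> 'c gfunct \<Rightarrow> (nat \<Rightarrow> nat \<Rightarrow> 'a \<times> 'b \<Rightarrow> 'c) \<Rightarrow>
    nat \<Rightarrow> (day_ob \<times> 'a \<times> 'b) set \<Rightarrow> 'c" where
  "day_lift F G H \<phi> Z = day_desc F G Z (\<lambda>k l v z. mor H (k * l) Z v (\<phi> k l z))"

text \<open>The associativity isomorphism sends the class of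
  \<open>v : m\<^sub>+ \<and> n\<^sub>+ \<rightarrow> Z\<^sub>+\<close>, \<open>[w : k\<^sub>+ \<and> l\<^sub>+ \<rightarrow> m\<^sub>+, a \<and> b] \<and> c\<close> to the class of
  \<open>v \<circ> (w \<and> id) : k\<^sub>+ \<and> (l\<^sub>+ \<and> n\<^sub>+) \<rightarrow> Z\<^sub>+\<close>, \<open>a \<and> [id, b \<and> c]\<close>.\<close>

definition day_assoc ::
  "'a gfunct \<Rightarrow> 'b gfunct \<Rightarrow> 'c gfunct \<Rightarrow> nat \<Rightarrow>
    (day_ob \<times> (day_ob \<times> 'a \<times> 'b) set \<times> 'c) set \<Rightarrow> (day_ob \<times> 'a \<times> (day_ob \<times> 'b \<times> 'c) set) set" where
  "day_assoc F G H = day_lift (F \<and>\<^sub>\<Gamma> G) H (F \<and>\<^sub>\<Gamma> G \<and>\<^sub>\<Gamma> H)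
     (\<lambda>m n. smash_fun (\<lambda>z. z) (obj (F \<and>\<^sub>\<Gamma> G) m) (obj H n) (\<lambda>q c.
        day_desc F G m (\<lambda>k l w (a, b).
          day_cls F (G \<and>\<^sub>\<Gamma> H) (m * n) k (l * n) (nsmash (k * l) n n w (\<lambda>j\<in>{0..n}. j))
            (smash_el (\<lambda>z. z) (obj F k) (obj (G \<and>\<^sub>\<Gamma> H) (l * n)) a
              (day_cls G H (l * n) l n (\<lambda>j\<in>{0..l * n}. j)
                (smash_el (\<lambda>z. z) (obj G l) (obj H n) b c)))) q))"

text \<open>The unit isomorphisms \<open>\<S> \<and> G \<rightarrow> G\<close> and \<open>F \<and> \<S> \<rightarrow> F\<close>: an element \<open>i \<in> k\<^sub>+\<close> acts on \<open>G(l\<^sub>+)\<close> by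
  \<open>G(j \<mapsto> i \<and> j)\<close>.\<close>

definition day_lunit :: "'b gfunct \<Rightarrow> nat \<Rightarrow> (day_ob \<times> nat \<times> 'b) set \<Rightarrow> 'b" where
  "day_lunit G = day_lift \<S> G G
     (\<lambda>k l. smash_fun (\<lambda>z. z) (std k) (obj G l) (\<lambda>i b. mor G l (k * l) (\<lambda>j\<in>{0..l}. nsm l i j) b))"

definition day_runit :: "'a gfunct \<Rightarrow> nat \<Rightarrow> (day_ob \<times> 'a \<times> nat) set \<Rightarrow> 'a" where
  "day_runit F = day_lift F \<S> F
     (\<lambda>k l. smash_fun (\<lambda>z. z) (obj F k) (std l) (\<lambda>a j. mor F k (k * l) (\<lambda>i\<in>{0..k}. nsm l i j) a))"

locale S_algebra =
  fixes A :: "'a gfunct" and m :: "nat \<Rightarrow> (day_ob \<times> 'a \<times> 'a) set \<Rightarrow> 'a" and u :: "nat \<Rightarrow> nat \<Rightarrow> 'a"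
  assumes Gamma_set: "Gamma_set A"
    and mult: "Gamma_hom (A \<and>\<^sub>\<Gamma> A) A m"
    and unit: "Gamma_hom \<S> A u"
    and assoc: "Gamma_comp ((A \<and>\<^sub>\<Gamma> A) \<and>\<^sub>\<Gamma> A) m (day_map (A \<and>\<^sub>\<Gamma> A) A A A m (Gamma_id A))
      = Gamma_comp ((A \<and>\<^sub>\<Gamma> A) \<and>\<^sub>\<Gamma> A) m
          (Gamma_comp ((A \<and>\<^sub>\<Gamma> A) \<and>\<^sub>\<Gamma> A) (day_map A (A \<and>\<^sub>\<Gamma> A) A A (Gamma_id A) m) (day_assoc A A A))"
    and unit_left: "Gamma_comp (\<S> \<and>\<^sub>\<Gamma> A) m (day_map \<S> A A A u (Gamma_id A)) = day_lunit A"
    and unit_right: "Gamma_comp (A \<and>\<^sub>\<Gamma> \<S>) m (day_map A \<S> A A (Gamma_id A) u) = day_runit A"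


section \<open>Restriction to \<open>\<Gamma>\<close>op and the assembly map\<close>

type_synonym 'u endo = "('u pset, 'u \<Rightarrow> 'u, 'u pset, 'u \<Rightarrow> 'u) funct"

text \<open>The inclusion of \<open>\<Gamma>\<close>op in the category of pointed sets.\<close>

definition fin_incl :: "(nat \<Rightarrow> 'u) \<Rightarrow> 'u gfunct" where
  "fin_incl num =
     \<lparr>obj = (\<lambda>k. \<lparr>car = num ` {0..k}, pt = num 0\<rparr>),
      mor = (\<lambda>k l f. \<lambda>x \<in> num ` {0..k}. num (f (inv num x)))\<rparr>"

definition restr :: "(nat \<Rightarrow> 'u) \<Rightarrow> 'u endo \<Rightarrow> 'u gfunct" where
  "restr num T = T \<circ>\<^sub>F fin_incl num"

text \<open>\<open>T\<close> is the extension of the \<open>\<Gamma>\<close>-set \<open>M\<close> to pointed sets: it restricts to \<open>M\<close>, and \<open>T(X)\<close> is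
  the colimit of the \<open>T(Y)\<close> over the finite pointed subsets \<open>Y\<close> of \<open>X\<close>.\<close>

definition fin_sub :: "'u pset \<Rightarrow> ('u pset, unit) cat" where
  "fin_sub X =
     \<lparr>Ob = {Y. finite (car Y) \<and> car Y \<subseteq> car X \<and> pt Y = pt X \<and> pt X \<in> car Y},
      Hom = (\<lambda>Y Y'. if car Y \<subseteq> car Y' then {()} else {}),
      Idt = (\<lambda>Y. ()),
      Cmp = (\<lambda>_ _ _ _ _. ())\<rparr>"

definition fin_sub_diag :: "('u pset, unit, 'u pset, 'u \<Rightarrow> 'u) funct" where
  "fin_sub_diag = \<lparr>obj = (\<lambda>Y. Y), mor = (\<lambda>Y Y' _. \<lambda>y \<in> car Y. y)\<rparr>"

definition is_extension ::
  "('u set \<Rightarrow> bool) \<Rightarrow> (nat \<Rightarrow> 'u) \<Rightarrow> 'u gfunct \<Rightarrow> 'u endo \<Rightarrow> bool" where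
  "is_extension small num M T \<longleftrightarrow>
     is_functor (Sets_pt small) (Sets_pt small) T \<and> restr num T = M \<and>
     (\<forall>X \<in> Ob (Sets_pt small). is_colimit (Sets_pt small) (fin_sub X) (T \<circ>\<^sub>F fin_sub_diag) (obj T X)
        (\<lambda>Y. mor T Y X (\<lambda>y \<in> car Y. y)))"

theorem algebraic_extension:
  fixes T :: "'u endo"
  assumes univ: "set_universe small num pair"
    and T: "is_functor (Sets_pt small) (Sets_pt small) T"
    and alg: "algebraic small T"
  shows "is_extension small num (restr num T) T"
  unfolding is_extension_def
proof (intro conjI ballI T refl)
  interpret set_universe small num pair by (fact univ)
  fix X :: "'u pset"
  assume "X \<in> Ob (Sets_pt small)"
  then have X: "pt X \<in> car X" "small (car X)" by (auto simp: Sets_pt_def)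
  obtain e where e: "inj_on e (Fpow (car X))" "small (e ` Fpow (car X))"
    using small_Fpow[OF X(2)] by blast
  define Q where "Q = Ob (fin_sub X)"
  define d where "d i = \<lparr>car = the_inv_into (Fpow (car X)) e i, pt = pt X\<rparr>" for i
  have d_e: "d (e (car Y)) = Y" if "Y \<in> Q" for Y
  proof -
    have "car Y \<in> Fpow (car X)" using that by (auto simp: Q_def fin_sub_def Fpow_def)
    then show ?thesis using that
      by (auto simp: d_def the_inv_into_f_f[OF e(1)] Q_def fin_sub_def)
  qed
  define J :: "('u, 'u) cat" where
    "J = \<lparr>Ob = (\<lambda>Y. e (car Y)) ` Q,
          Hom = (\<lambda>i j. if car (d i) \<subseteq> car (d j) then {num 0} else {}),
          Idt = (\<lambda>_. num 0), Cmp = (\<lambda>_ _ _ _ _. num 0)\<rparr>"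
  define D :: "('u, 'u, 'u pset, 'u \<Rightarrow> 'u) funct" where
    "D = \<lparr>obj = d, mor = (\<lambda>i j _. \<lambda>y \<in> car (d i). y)\<rparr>"
  have d_Q: "d i \<in> Q" if "i \<in> Ob J" for i
    using that d_e by (auto simp: J_def)
  have e_J: "e (car Y) \<in> Ob J" if "Y \<in> Q" for Y
    using that by (auto simp: J_def)
  have d_small: "small (car Y)" if "Y \<in> Q" for Y
    using that by (auto simp: Q_def fin_sub_def small_finite)
  have d_pt: "pt Y = pt X" "pt X \<in> car Y" "car Y \<subseteq> car X" "finite (car Y)" if "Y \<in> Q" for Y
    using that by (auto simp: Q_def fin_sub_def)
  have catJ: "category J"
    by unfold_locales (auto simp: J_def split: if_splits)
  have smallJ: "small (Ob J)"
  proof (rule small_subset[OF e(2)])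
    show "Ob J \<subseteq> e ` Fpow (car X)"
      by (auto simp: J_def Q_def fin_sub_def Fpow_def)
  qed
  have smallJ': "small (\<Union>i\<in>Ob J. \<Union>j\<in>Ob J. Hom J i j)"
    by (rule small_subset[OF small_finite[of "{num 0}"]]) (auto simp: J_def split: if_splits)
  have filt: "filtered J"
    unfolding filtered_def
  proof (intro conjI ballI)
    have "\<lparr>car = {pt X}, pt = pt X\<rparr> \<in> Q" using X by (auto simp: Q_def fin_sub_def)
    then show "Ob J \<noteq> {}" using e_J by blast
  next
    fix i j assume i: "i \<in> Ob J" and j: "j \<in> Ob J"
    let ?K = "\<lparr>car = car (d i) \<union> car (d j), pt = pt X\<rparr>"
    have K: "?K \<in> Q" using d_Q[OF i] d_Q[OF j] by (auto simp: Q_def fin_sub_def)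
    show "\<exists>k\<in>Ob J. Hom J i k \<noteq> {} \<and> Hom J j k \<noteq> {}"
      by (rule bexI[OF _ e_J[OF K]]) (use d_e[OF K] in \<open>auto simp: J_def\<close>)
  next
    fix i j f g assume i: "i \<in> Ob J" and j: "j \<in> Ob J"
    show "\<exists>k\<in>Ob J. \<exists>h\<in>Hom J j k. Cmp J i j k h f = Cmp J i j k h g"
      by (rule bexI[OF _ j]) (auto simp: J_def)
  qed
  have D: "is_functor J (Sets_pt small) D"
  proof
    fix i assume i: "i \<in> Ob J"
    show "obj D i \<in> Ob (Sets_pt small)"
      using d_pt[OF d_Q[OF i]] d_small[OF d_Q[OF i]] by (simp add: D_def Sets_pt_def)
    show "mor D i i (Idt J i) = Idt (Sets_pt small) (obj D i)"
      by (simp add: D_def Sets_pt_def)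
  next
    fix i j f assume "i \<in> Ob J" "j \<in> Ob J" "f \<in> Hom J i j"
    then show "mor D i j f \<in> Hom (Sets_pt small) (obj D i) (obj D j)"
      using d_pt[OF d_Q, of i] d_pt[OF d_Q, of j]
      by (auto simp: D_def Sets_pt_def pmaps_def J_def split: if_splits)
  next
    fix i j k f g
    assume "i \<in> Ob J" "j \<in> Ob J" "k \<in> Ob J" "f \<in> Hom J i j" "g \<in> Hom J j k"
    then show "mor D i k (Cmp J i j k g f)
      = Cmp (Sets_pt small) (obj D i) (obj D j) (obj D k) (mor D j k g) (mor D i j f)"
      by (auto simp: D_def Sets_pt_def J_def compose_def fun_eq_iff split: if_splits)
  qed
  have colim: "is_colimit (Sets_pt small) J D X (\<lambda>i. \<lambda>y \<in> car (d i). y)"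
    unfolding is_colimit_def
  proof (intro conjI allI impI)
    show "is_cocone (Sets_pt small) J D X (\<lambda>i. \<lambda>y \<in> car (d i). y)"
      unfolding is_cocone_def
    proof (intro conjI ballI)
      show "X \<in> Ob (Sets_pt small)" using X by (simp add: Sets_pt_def)
    next
      fix i assume i: "i \<in> Ob J"
      show "(\<lambda>y \<in> car (d i). y) \<in> Hom (Sets_pt small) (obj D i) X"
        using d_pt[OF d_Q[OF i]] by (auto simp: Sets_pt_def D_def pmaps_def)
    next
      fix i j f assume "f \<in> Hom J i j"
      then have "car (d i) \<subseteq> car (d j)" by (simp add: J_def split: if_splits)
      then show "Cmp (Sets_pt small) (obj D i) (obj D j) X (\<lambda>y \<in> car (d j). y) (mor D i j f)
          = (\<lambda>y \<in> car (d i). y)"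
        by (auto simp: Sets_pt_def D_def compose_def fun_eq_iff)
    qed
  next
    fix L' c' assume c': "is_cocone (Sets_pt small) J D L' c'"
    define S where "S x = \<lparr>car = {pt X, x}, pt = pt X\<rparr>" for x
    have S: "S x \<in> Q" if "x \<in> car X" for x
      using that X by (auto simp: S_def Q_def fin_sub_def)
    have c'_pmaps: "c' i \<in> pmaps (d i) L'" if "i \<in> Ob J" for i
      using c' that by (auto simp: is_cocone_def Sets_pt_def D_def)
    define h where "h = (\<lambda>x \<in> car X. c' (e (car (S x))) x)"
    have c'_h: "c' i y = h y" if i: "i \<in> Ob J" and y: "y \<in> car (d i)" for i y
    proof -
      have yX: "y \<in> car X" using d_pt[OF d_Q[OF i]] y by auto
      let ?s = "e (car (S y))"
      have s: "?s \<in> Ob J" "d ?s = S y" using e_J d_e S[OF yX] by auto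
      have "num 0 \<in> Hom J ?s i"
        using s d_pt[OF d_Q[OF i]] y by (auto simp: J_def S_def)
      then have "Cmp (Sets_pt small) (obj D ?s) (obj D i) L' (c' i) (mor D ?s i (num 0)) = c' ?s"
        using c' s i unfolding is_cocone_def by blast
      then have "compose (car (S y)) (c' i) (\<lambda>y \<in> car (S y). y) = c' ?s"
        by (simp add: Sets_pt_def D_def s)
      from fun_cong[OF this, of y] show ?thesis
        using yX by (simp add: compose_def S_def h_def)
    qed
    show "\<exists>!h. h \<in> Hom (Sets_pt small) X L' \<and>
      (\<forall>i\<in>Ob J. Cmp (Sets_pt small) (obj D i) X L' h (\<lambda>y \<in> car (d i). y) = c' i)"
    proof (rule ex1I[of _ h], intro conjI ballI)
      have "h x \<in> car L'" if x: "x \<in> car X" for x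
      proof -
        have "x \<in> car (d (e (car (S x))))" by (simp add: d_e[OF S[OF x]]) (simp add: S_def)
        then show ?thesis
          using c'_pmaps[OF e_J[OF S[OF x]]] x by (auto simp: pmaps_def h_def)
      qed
      moreover have "h (pt X) = pt L'"
        using c'_pmaps[OF e_J[OF S[OF X(1)]]] X(1) d_e[OF S[OF X(1)]]
        by (simp add: pmaps_def h_def S_def)
      ultimately show "h \<in> Hom (Sets_pt small) X L'"
        by (auto simp: Sets_pt_def pmaps_def h_def)
    next
      fix i assume i: "i \<in> Ob J"
      show "Cmp (Sets_pt small) (obj D i) X L' h (\<lambda>y \<in> car (d i). y) = c' i"
      proof
        fix y show "Cmp (Sets_pt small) (obj D i) X L' h (\<lambda>y \<in> car (d i). y) y = c' i y"
          using c'_h[OF i] c'_pmaps[OF i]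
          by (cases "y \<in> car (d i)")
            (auto simp: Sets_pt_def D_def compose_def pmaps_def PiE_def extensional_def)
      qed
    next
      fix h' assume h': "h' \<in> Hom (Sets_pt small) X L' \<and>
        (\<forall>i\<in>Ob J. Cmp (Sets_pt small) (obj D i) X L' h' (\<lambda>y \<in> car (d i). y) = c' i)"
      show "h' = h"
      proof
        fix x show "h' x = h x"
        proof (cases "x \<in> car X")
          case True
          let ?s = "e (car (S x))"
          have s: "?s \<in> Ob J" "d ?s = S x" using e_J d_e S[OF True] by auto
          have "compose (car (S x)) h' (\<lambda>y \<in> car (S x). y) = c' ?s"
            using h' s by (auto simp: Sets_pt_def D_def)
          from fun_cong[OF this, of x] show ?thesis
            using True by (simp add: compose_def S_def h_def)
        next
          case False
          then show ?thesis using h'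
            by (auto simp: Sets_pt_def pmaps_def h_def PiE_def extensional_def)
        qed
      qed
    qed
  qed
  have main: "is_colimit (Sets_pt small) J (T \<circ>\<^sub>F D) (obj T X) (\<lambda>i. mor T (d i) X (\<lambda>y \<in> car (d i). y))"
    using alg[unfolded algebraic_def, rule_format, of J D X "\<lambda>i. \<lambda>y \<in> car (d i). y"]
      catJ smallJ smallJ' filt D colim by (simp add: D_def)
  let ?C = "Sets_pt small"
  have Q_eq: "Q = d ` Ob J"
    using d_Q e_J d_e by force
  have all: "(\<forall>Y\<in>Q. P Y) \<longleftrightarrow> (\<forall>i\<in>Ob J. P (d i))" for P
    by (simp add: Q_eq)
  have cocone_iff: "is_cocone ?C (fin_sub X) (T \<circ>\<^sub>F fin_sub_diag) L c
      \<longleftrightarrow> is_cocone ?C J (T \<circ>\<^sub>F D) L (\<lambda>i. c (d i))" for L c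
  proof -
    have hom: "() \<in> Hom (fin_sub X) (d i) (d j) \<longleftrightarrow> (\<exists>f. f \<in> Hom J i j)" for i j
      by (auto simp: fin_sub_def J_def)
    show ?thesis
      unfolding is_cocone_def Q_def[symmetric] all
      by (simp add: comp_funct_def fin_sub_diag_def D_def hom)
  qed
  show "is_colimit ?C (fin_sub X) (T \<circ>\<^sub>F fin_sub_diag) (obj T X) (\<lambda>Y. mor T Y X (\<lambda>y \<in> car Y. y))"
    unfolding is_colimit_def cocone_iff Q_def[symmetric] all
  proof (intro conjI allI impI)
    show "is_cocone ?C J (T \<circ>\<^sub>F D) (obj T X) (\<lambda>i. mor T (d i) X (\<lambda>y \<in> car (d i). y))"
      using main by (simp add: is_colimit_def)
  next
    fix L' c' assume "is_cocone ?C J (T \<circ>\<^sub>F D) L' (\<lambda>i. c' (d i))"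
    then show "\<exists>!h. h \<in> Hom ?C (obj T X) L' \<and> (\<forall>i\<in>Ob J.
        Cmp ?C (obj (T \<circ>\<^sub>F fin_sub_diag) (d i)) (obj T X) L' h (mor T (d i) X (\<lambda>y \<in> car (d i). y))
          = c' (d i))"
      using main unfolding is_colimit_def
      by (simp add: comp_funct_def fin_sub_diag_def D_def)
  qed
qed

text \<open>\<open>\<iota> : X \<and> U(Y) \<rightarrow> U(X \<and> Y)\<close>, \<open>x \<and> b \<mapsto> U(\<delta>\<^sub>x)(b)\<close>.\<close>

definition iota :: "('u \<times> 'u \<Rightarrow> 'u) \<Rightarrow> 'u endo \<Rightarrow> 'u pset \<Rightarrow> 'u pset \<Rightarrow> 'u \<Rightarrow> 'u" where
  "iota pair U X Y = smash_fun pair X (obj U Y)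
     (\<lambda>x b. mor U Y (smash pair X Y) (\<lambda>y \<in> car Y. smash_el pair X Y x y) b)"

definition swap :: "('u \<times> 'u \<Rightarrow> 'u) \<Rightarrow> 'u pset \<Rightarrow> 'u pset \<Rightarrow> 'u \<Rightarrow> 'u" where
  "swap pair X Y = smash_fun pair X Y (\<lambda>x y. smash_el pair Y X y x)"

text \<open>\<open>\<alpha> : T(X) \<and> U(Y) \<rightarrow> T(X \<and> U(Y)) \<rightarrow> T(U(X \<and> Y))\<close>. The arguments \<open>T\<close> and \<open>U\<close> are the
  extensions of the two \<open>\<Gamma>\<close>-sets \<open>M\<close> and \<open>N\<close> to pointed sets; by \<open>algebraic_extension\<close>, an
  algebraic \<open>T\<close> is the extension of \<open>restr num T\<close>.\<close>

definition alpha ::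
  "('u \<times> 'u \<Rightarrow> 'u) \<Rightarrow> 'u endo \<Rightarrow> 'u endo \<Rightarrow> 'u pset \<Rightarrow> 'u pset \<Rightarrow> 'u \<times> 'u \<Rightarrow> 'u" where
  "alpha pair T U X Y = smash_fun (\<lambda>z. z) (obj T X) (obj U Y) (\<lambda>a b.
     mor T (smash pair X (obj U Y)) (obj U (smash pair X Y)) (iota pair U X Y)
       (mor T (smash pair (obj U Y) X) (smash pair X (obj U Y)) (swap pair (obj U Y) X)
         (iota pair T (obj U Y) X (smash_el pair (obj U Y) (obj T X) b a))))"

text \<open>The identification of \<open>k\<^sub>+ \<and> l\<^sub>+\<close> with \<open>(k * l)\<^sub>+\<close> inside the category of pointed sets.\<close>

definition fin_smash :: "(nat \<Rightarrow> 'u) \<Rightarrow> ('u \<times> 'u \<Rightarrow> 'u) \<Rightarrow> nat \<Rightarrow> nat \<Rightarrow> 'u \<Rightarrow> 'u" where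
  "fin_smash num pair k l = smash_fun pair (obj (fin_incl num) k) (obj (fin_incl num) l)
     (\<lambda>x y. num (nsm l (inv num x) (inv num y)))"

text \<open>The assembly map \<open>M \<and> N \<rightarrow> T \<circ> N\<close>, for \<open>M\<close>, \<open>N\<close> with extensions \<open>T\<close>, \<open>U\<close>.\<close>

definition assembly ::
  "(nat \<Rightarrow> 'u) \<Rightarrow> ('u \<times> 'u \<Rightarrow> 'u) \<Rightarrow> 'u endo \<Rightarrow> 'u endo \<Rightarrow> nat \<Rightarrow> (day_ob \<times> 'u \<times> 'u) set \<Rightarrow> 'u" where
  "assembly num pair T U = day_lift (restr num T) (restr num U) (T \<circ>\<^sub>F restr num U)
     (\<lambda>k l. let X = obj (fin_incl num) k; Y = obj (fin_incl num) l in
        compose (car (obj T X \<and>\<^sub>* obj U Y))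
          (mor (T \<circ>\<^sub>F U) (smash pair X Y) (obj (fin_incl num) (k * l)) (fin_smash num pair k l))
          (alpha pair T U X Y))"

text \<open>The product \<open>\<mu> \<circ> \<alpha>\<close> and the unit of the restriction of a monad.\<close>

definition restr_mult ::
  "(nat \<Rightarrow> 'u) \<Rightarrow> ('u \<times> 'u \<Rightarrow> 'u) \<Rightarrow> 'u endo \<Rightarrow> ('u pset \<Rightarrow> 'u \<Rightarrow> 'u) \<Rightarrow>
    nat \<Rightarrow> (day_ob \<times> 'u \<times> 'u) set \<Rightarrow> 'u" where
  "restr_mult num pair T \<mu> =
     Gamma_comp (restr num T \<and>\<^sub>\<Gamma> restr num T) (\<lambda>k. \<mu> (obj (fin_incl num) k)) (assembly num pair T T)"

definition restr_unit :: "(nat \<Rightarrow> 'u) \<Rightarrow> ('u pset \<Rightarrow> 'u \<Rightarrow> 'u) \<Rightarrow> nat \<Rightarrow> nat \<Rightarrow> 'u" where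
  "restr_unit num \<epsilon> k = (\<lambda>i\<in>{0..k}. \<epsilon> (obj (fin_incl num) k) (num i))"

end

(* A morphism from a Day convolution is a family of external products p(a, b) in A(k /\ l), natural in
   k and l, and the axioms of an S-algebra amount to associativity and unit laws for p. For the
   product in the theorem, unfolding the assembly map gives, in terms of the Kleisli extension
   bind h = mu o T(h),
     p(a, b) = bind (x |-> T(y |-> x /\ y)(b)) (a).
   Associativity holds because both bracketings of a, b, c equal
     bind (x |-> bind (y |-> T(z |-> x /\ y /\ z)(c)) (b)) (a),
   by associativity and naturality of mu; the unit laws are those of bind. *)

theory Submission
  imports Defs
begin

text \<open>A map out of a Day convolution assigns one value to each colimit class, so every formula
  for such a map must first be shown constant on classes. This is paid for once:
  \<open>day_el\<close> names the class of a pair of elements over an index map, every element of a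
  convolution is such a class (\<open>car_day\<close>), and \<open>day_desc_el\<close> reduces
  evaluation to vanishing at base points and compatibility with the index morphisms. All later
  identities are checked on these generators. In the skeleton, the lexicographic numbering of pairs
  makes reassociation of smash products strict: both bracketings of three factors land in the same
  object, \<open>A\<close> at \<open>k * l * n\<close>, so associativity of \<open>p\<close> is a
  plain equation without coherence isomorphisms. The asymmetry of the formula comes from alpha,
  which puts the functor of the first factor outside.\<close>

lemma pmaps_in: "\<lbrakk>f \<in> pmaps X Y; x \<in> car X\<rbrakk> \<Longrightarrow> f x \<in> car Y"
  by (auto simp: pmaps_def)

lemma pmaps_pt: "f \<in> pmaps X Y \<Longrightarrow> f (pt X) = pt Y"
  by (simp add: pmaps_def)

lemma pmaps_extensional: "f \<in> pmaps X Y \<Longrightarrow> f \<in> extensional (car X)"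
  by (auto simp: pmaps_def PiE_def)

lemma pmapsI:
  "\<lbrakk>\<And>x. x \<in> car X \<Longrightarrow> f x \<in> car Y; f \<in> extensional (car X); f (pt X) = pt Y\<rbrakk> \<Longrightarrow> f \<in> pmaps X Y"
  by (auto simp: pmaps_def PiE_def)

lemma pmaps_compose:
  "\<lbrakk>f \<in> pmaps X Y; g \<in> pmaps Y Z; pt X \<in> car X\<rbrakk> \<Longrightarrow> compose (car X) g f \<in> pmaps X Z"
  by (rule pmapsI) (auto simp: compose_def pmaps_in pmaps_pt)

section \<open>Smash products and colimits of pointed sets\<close>

lemma smash_el_in: "\<lbrakk>x \<in> car X; y \<in> car Y\<rbrakk> \<Longrightarrow> smash_el p X Y x y \<in> car (smash p X Y)"
  by (auto simp: smash_def)

lemma smash_cases: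
  assumes "z \<in> car (smash p X Y)"
  obtains x y where "x \<in> car X" "y \<in> car Y" "z = smash_el p X Y x y"
  using assms by (auto simp: smash_def)

lemma smash_el_pt [simp]:
  "smash_el p X Y (pt X) y = pt (smash p X Y)"
  "smash_el p X Y x (pt Y) = pt (smash p X Y)"
  by (simp_all add: smash_el_def smash_def)

lemma pt_smash_in: "\<lbrakk>pt X \<in> car X; pt Y \<in> car Y\<rbrakk> \<Longrightarrow> pt (smash p X Y) \<in> car (smash p X Y)"
  using smash_el_in[of "pt X" X "pt Y" Y p] by simp

text \<open>Elements on the two axes are all represented by the pair of base points, so evaluation
  there forgets \<open>x\<close> and \<open>y\<close>; it still gives \<open>h x y\<close> because
  \<open>h\<close> has the single value \<open>b\<close> on both axes.\<close>

lemma smash_fun_el: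
  assumes "inj p" and x: "x \<in> car X" and y: "y \<in> car Y"
    and "pt X \<in> car X" "pt Y \<in> car Y"
    and "\<And>y. y \<in> car Y \<Longrightarrow> h (pt X) y = b" "\<And>x. x \<in> car X \<Longrightarrow> h x (pt Y) = b"
  shows "smash_fun p X Y h (smash_el p X Y x y) = h x y"
proof -
  have "smash_fun p X Y h (smash_el p X Y x y) = case_prod h (inv p (smash_el p X Y x y))"
    using smash_el_in[OF x y, of p] by (simp add: smash_fun_def)
  then show ?thesis
    using assms by (auto simp: smash_el_def inv_f_f)
qed

lemma smash_map_el:
  assumes "f \<in> pmaps X X'" "g \<in> pmaps Y Y'" "x \<in> car X" "y \<in> car Y" "pt X \<in> car X" "pt Y \<in> car Y"
  shows "smash_map X Y X' Y' f g (smash_el (\<lambda>z. z) X Y x y) = smash_el (\<lambda>z. z) X' Y' (f x) (g y)"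
  unfolding smash_map_def
  by (rule smash_fun_el[where b = "pt (X' \<and>\<^sub>* Y')"]) (use assms in \<open>auto simp: pmaps_pt\<close>)

text \<open>The closure of the symmetrised generators is an equivalence relation, so related
  elements have the same image.\<close>

lemma colim_cls_eq:
  assumes "((i, x), (j, y)) \<in> colim_gen J D"
  shows "colim_cls J D i x = colim_cls J D j y"
proof -
  let ?r = "colim_gen J D \<union> (colim_gen J D)\<inverse>"
  have "sym (?r\<^sup>*)" by (rule sym_rtrancl) (auto simp: sym_def)
  moreover have "((i, x), (j, y)) \<in> ?r\<^sup>*" using assms by blast
  ultimately have "((i, x), w) \<in> ?r\<^sup>* \<longleftrightarrow> ((j, y), w) \<in> ?r\<^sup>*" for w
    by (meson rtrancl_trans symD)
  then show ?thesis by (auto simp: colim_cls_def)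
qed

lemma colim_cls_mor:
  "\<lbrakk>i \<in> Ob J; j \<in> Ob J; f \<in> Hom J i j; x \<in> car (obj D i)\<rbrakk>
    \<Longrightarrow> colim_cls J D j (mor D i j f x) = colim_cls J D i x"
  by (rule colim_cls_eq[symmetric]) (auto simp: colim_gen_def)

text \<open>The base point of \<open>colim\<close> is defined as a union over all indices; the
  generators identify all base points, so the union is over one and the same class.\<close>

lemma colim_cls_pt:
  assumes "i \<in> Ob J"
  shows "colim_cls J D i (pt (obj D i)) = pt (colim J D)"
proof -
  have "colim_cls J D j (pt (obj D j)) = colim_cls J D i (pt (obj D i))" if "j \<in> Ob J" for j
    by (rule colim_cls_eq) (use assms that in \<open>auto simp: colim_gen_def\<close>)
  then have "(\<Union>j\<in>Ob J. colim_cls J D j (pt (obj D j))) = colim_cls J D i (pt (obj D i))"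
    using assms by blast
  then show ?thesis by (simp add: colim_def)
qed

section \<open>Day convolution\<close>

abbreviation Gamma_functor :: "'a gfunct \<Rightarrow> bool" where
  "Gamma_functor F \<equiv> is_functor Gamma_op (Sets_pt (\<lambda>_. True)) F"

lemma car_std [simp]: "car (std k) = {0..k}" and pt_std [simp]: "pt (std k) = 0"
  by (simp_all add: std_def)

lemma std_id: "(\<lambda>i\<in>{0..k}. i) \<in> pmaps (std k) (std k)"
  by (auto simp: pmaps_def)

lemma std_compose:
  "\<lbrakk>f \<in> pmaps (std k) (std l); g \<in> pmaps (std l) (std m)\<rbrakk>
    \<Longrightarrow> compose {0..k} g f \<in> pmaps (std k) (std m)"
  using pmaps_compose[of f "std k" "std l" g "std m"] by simp

lemma std_compose_id: "f \<in> pmaps (std k) (std l) \<Longrightarrow> compose {0..k} f (\<lambda>i\<in>{0..k}. i) = f"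
  by (rule compose_Id) (auto simp: pmaps_def PiE_def)

lemma std_id_compose: "f \<in> pmaps (std k) (std l) \<Longrightarrow> compose {0..k} (\<lambda>i\<in>{0..l}. i) f = f"
  by (rule Id_compose) (auto simp: pmaps_def PiE_def)

lemma Gamma_functor_pt: "Gamma_functor F \<Longrightarrow> pt (obj F k) \<in> car (obj F k)"
  using is_functor.obj_in[of Gamma_op "Sets_pt (\<lambda>_. True)" F k]
  by (simp add: Gamma_op_def Sets_pt_def)

lemma Gamma_functor_mor:
  "\<lbrakk>Gamma_functor F; f \<in> pmaps (std k) (std l)\<rbrakk> \<Longrightarrow> mor F k l f \<in> pmaps (obj F k) (obj F l)"
  using is_functor.mor_in[of Gamma_op "Sets_pt (\<lambda>_. True)" F k l f]
  by (simp add: Gamma_op_def Sets_pt_def)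

lemma Gamma_functor_id:
  "\<lbrakk>Gamma_functor F; x \<in> car (obj F k)\<rbrakk> \<Longrightarrow> mor F k k (\<lambda>i\<in>{0..k}. i) x = x"
  using is_functor.mor_idt[of Gamma_op "Sets_pt (\<lambda>_. True)" F k]
  by (simp add: Gamma_op_def Sets_pt_def)

lemma Gamma_functor_comp:
  "\<lbrakk>Gamma_functor F; f \<in> pmaps (std k) (std l); g \<in> pmaps (std l) (std m); x \<in> car (obj F k)\<rbrakk>
    \<Longrightarrow> mor F l m g (mor F k l f x) = mor F k m (compose {0..k} g f) x"
  using is_functor.mor_cmp[of Gamma_op "Sets_pt (\<lambda>_. True)" F k l m f g]
  by (simp add: Gamma_op_def Sets_pt_def compose_eq)

lemma Gamma_functorI:
  assumes "\<And>k. pt (obj F k) \<in> car (obj F k)"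
    and "\<And>k l f. f \<in> pmaps (std k) (std l) \<Longrightarrow> mor F k l f \<in> pmaps (obj F k) (obj F l)"
    and "\<And>k x. x \<in> car (obj F k) \<Longrightarrow> mor F k k (\<lambda>i\<in>{0..k}. i) x = x"
    and "\<And>k l m f g x. \<lbrakk>f \<in> pmaps (std k) (std l); g \<in> pmaps (std l) (std m); x \<in> car (obj F k)\<rbrakk>
      \<Longrightarrow> mor F k m (compose {0..k} g f) x = mor F l m g (mor F k l f x)"
  shows "Gamma_functor F"
proof
  fix k l m f g
  show "obj F k \<in> Ob (Sets_pt (\<lambda>_. True))"
    using assms(1) by (simp add: Sets_pt_def)
  show "f \<in> Hom Gamma_op k l \<Longrightarrow> mor F k l f \<in> Hom (Sets_pt (\<lambda>_. True)) (obj F k) (obj F l)"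
    using assms(2) by (simp add: Sets_pt_def Gamma_op_def)
  show "mor F k k (Idt Gamma_op k) = Idt (Sets_pt (\<lambda>_. True)) (obj F k)"
    using assms(3) pmaps_extensional[OF assms(2)[OF std_id[of k]]]
    by (auto simp: Sets_pt_def Gamma_op_def intro!: extensionalityI)
  show "\<lbrakk>f \<in> Hom Gamma_op k l; g \<in> Hom Gamma_op l m\<rbrakk> \<Longrightarrow> mor F k m (Cmp Gamma_op k l m g f)
    = Cmp (Sets_pt (\<lambda>_. True)) (obj F k) (obj F l) (obj F m) (mor F l m g) (mor F k l f)"
    using assms(4) pmaps_extensional[OF assms(2)[OF std_compose[of f k l g m]]]
    by (auto simp: Sets_pt_def Gamma_op_def compose_eq intro!: extensionalityI)
qed

section \<open>The numbering of smash products in the skeleton\<close>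

lemma nsm_surj:
  assumes "n \<le> k * l"
  obtains i j where "i \<le> k" "j \<le> l" "n = nsm l i j"
proof (cases "n = 0")
  case True
  then show ?thesis using that[of 0 0] by (simp add: nsm_def)
next
  case False
  then have "l > 0" using assms by (cases l) auto
  \<comment> \<open>Division with remainder of \<open>n - 1\<close> by \<open>l\<close> recovers the
    pair; the shifts by one keep 0 free for the base point.\<close>
  have "(n - 1) div l < k"
    using False assms \<open>l > 0\<close> by (subst div_less_iff_less_mult) auto
  moreover have "(n - 1) mod l < l" using \<open>l > 0\<close> by simp
  moreover have "n = nsm l ((n - 1) div l + 1) ((n - 1) mod l + 1)"
    using False div_mult_mod_eq[of "n - 1" l] by (simp add: nsm_def)
  ultimately show ?thesis using that[of "(n - 1) div l + 1" "(n - 1) mod l + 1"] by simp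
qed

lemma nsm_0 [simp]: "nsm l 0 j = 0" "nsm l i 0 = 0"
  by (simp_all add: nsm_def)

lemma nsmash_pmaps:
  assumes f: "f \<in> pmaps (std k) (std k')" and g: "g \<in> pmaps (std l) (std l')"
  shows "nsmash k l l' f g \<in> pmaps (std (k * l)) (std (k' * l'))"
proof (rule pmapsI)
  fix n assume "n \<in> car (std (k * l))"
  then have "n \<le> k * l" by simp
  then obtain i j where ij: "i \<le> k" "j \<le> l" "n = nsm l i j" by (rule nsm_surj)
  then show "nsmash k l l' f g n \<in> car (std (k' * l'))"
    using nsmash_nsm[OF f g ij(1,2)] pmaps_in[OF f, of i] pmaps_in[OF g, of j] by (simp add: nsm_le)
qed (auto simp: nsmash_def)

text \<open>Since all numbers up to \<open>k * l\<close> are smash elements, identities between maps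
  on a smash product can be checked on pairs, where \<open>nsmash_nsm\<close> computes.\<close>

lemma nsm_ext:
  assumes "f \<in> extensional {0..k * l}" "g \<in> extensional {0..k * l}"
    and "\<And>i j. \<lbrakk>i \<le> k; j \<le> l\<rbrakk> \<Longrightarrow> f (nsm l i j) = g (nsm l i j)"
  shows "f = g"
proof (rule extensionalityI[OF assms(1,2)])
  fix n assume "n \<in> {0..k * l}"
  then have "n \<le> k * l" by simp
  then obtain i j where "i \<le> k" "j \<le> l" "n = nsm l i j" by (rule nsm_surj)
  with assms(3) show "f n = g n" by simp
qed

lemma nsmash_extensional [simp]: "nsmash k l l' f g \<in> extensional {0..k * l}"
  by (simp add: nsmash_def)

lemma nsmash_compose:
  assumes "f \<in> pmaps (std k) (std k')" "f' \<in> pmaps (std k') (std k'')"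
    "g \<in> pmaps (std l) (std l')" "g' \<in> pmaps (std l') (std l'')"
  shows "compose {0..k * l} (nsmash k' l' l'' f' g') (nsmash k l l' f g)
    = nsmash k l l'' (compose {0..k} f' f) (compose {0..l} g' g)"
proof (rule nsm_ext)
  fix i j assume ij: "i \<le> k" "j \<le> l"
  have "f i \<le> k'" "g j \<le> l'" using assms(1,3) ij pmaps_in by fastforce+
  then show "compose {0..k * l} (nsmash k' l' l'' f' g') (nsmash k l l' f g) (nsm l i j)
    = nsmash k l l'' (compose {0..k} f' f) (compose {0..l} g' g) (nsm l i j)"
    using assms ij by (simp add: compose_eq nsm_le nsmash_nsm[OF _ _ ij, of _ k' _ l']
      nsmash_nsm[OF _ _ ij, of _ k'' _ l''] nsmash_nsm[of _ k' k'' _ l' l''] std_compose)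
qed simp_all

text \<open>On triples this is \<open>nsm_assoc\<close>. The two domains are given by equal numbers,
  so the two sides are literally the same function.\<close>

lemma nsmash_assoc:
  assumes "f \<in> pmaps (std k) (std k')" "g \<in> pmaps (std l) (std l')" "h \<in> pmaps (std n) (std n')"
  shows "nsmash (k * l) n n' (nsmash k l l' f g) h = nsmash k (l * n) (l' * n') f (nsmash l n n' g h)"
proof (rule nsm_ext)
  fix i j assume "i \<le> k * l" and j: "j \<le> n"
  then obtain a b where ab: "a \<le> k" "b \<le> l" "i = nsm l a b" by (metis nsm_surj)
  show "nsmash (k * l) n n' (nsmash k l l' f g) h (nsm n i j)
    = nsmash k (l * n) (l' * n') f (nsmash l n n' g h) (nsm n i j)"
    using nsmash_nsm[OF nsmash_pmaps[OF assms(1,2)] assms(3) \<open>i \<le> k * l\<close> j]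
      nsmash_nsm[OF assms(1) nsmash_pmaps[OF assms(2,3)] ab(1) nsm_le[OF ab(2) j]]
      nsmash_nsm[OF assms(1,2) ab(1,2)] nsmash_nsm[OF assms(2,3) ab(2) j]
    by (simp add: ab(3) nsm_assoc)
qed (simp_all add: nsmash_def mult.assoc)

section \<open>Day convolution through generators\<close>

definition day_el :: "'a gfunct \<Rightarrow> 'b gfunct \<Rightarrow> nat \<Rightarrow> nat \<Rightarrow> nat \<Rightarrow> (nat \<Rightarrow> nat) \<Rightarrow> 'a \<Rightarrow> 'b
    \<Rightarrow> (day_ob \<times> 'a \<times> 'b) set" where
  "day_el F G Z k l v a b = day_cls F G Z k l v (smash_el (\<lambda>z. z) (obj F k) (obj G l) a b)"

lemma day_idx_Ob [simp]: "(k, l, v) \<in> Ob (day_idx Z) \<longleftrightarrow> v \<in> pmaps (std (k * l)) (std Z)"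
  by (simp add: day_idx_def)

lemma day_idx_Hom [simp]: "(f, g) \<in> Hom (day_idx Z) (k, l, v) (k', l', v') \<longleftrightarrow>
    f \<in> pmaps (std k) (std k') \<and> g \<in> pmaps (std l) (std l') \<and>
    compose {0..k * l} v' (nsmash k l l' f g) = v"
  by (simp add: day_idx_def)

lemma day_diag_obj [simp]: "obj (day_diag F G) (k, l, v) = obj F k \<and>\<^sub>* obj G l"
  by (simp add: day_diag_def)

text \<open>This makes induction over generators available: each class has a representative in some
  smash product, and each element of a smash product comes from a pair.\<close>

lemma car_day: "car (obj (F \<and>\<^sub>\<Gamma> G) Z) = {day_el F G Z k l v a b |k l v a b.
    v \<in> pmaps (std (k * l)) (std Z) \<and> a \<in> car (obj F k) \<and> b \<in> car (obj G l)}"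
proof -
  have "car (obj (F \<and>\<^sub>\<Gamma> G) Z) = {day_cls F G Z k l v z |k l v z.
      v \<in> pmaps (std (k * l)) (std Z) \<and> z \<in> car (obj F k \<and>\<^sub>* obj G l)}"
    by (simp add: day_def colim_def split_paired_Ex)
  also have "\<dots> = {day_el F G Z k l v a b |k l v a b.
      v \<in> pmaps (std (k * l)) (std Z) \<and> a \<in> car (obj F k) \<and> b \<in> car (obj G l)}" (is "?L = ?R")
  proof (intro subset_antisym subsetI)
    fix q assume "q \<in> ?L"
    then obtain k l v z where *: "v \<in> pmaps (std (k * l)) (std Z)" "z \<in> car (obj F k \<and>\<^sub>* obj G l)"
      "q = day_cls F G Z k l v z" by blast
    from *(2) obtain a b where "a \<in> car (obj F k)" "b \<in> car (obj G l)"
      "z = smash_el (\<lambda>z. z) (obj F k) (obj G l) a b" by (rule smash_cases)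
    with * show "q \<in> ?R" unfolding day_el_def by blast
  next
    fix q assume "q \<in> ?R"
    then obtain k l v a b where *: "v \<in> pmaps (std (k * l)) (std Z)"
      "a \<in> car (obj F k)" "b \<in> car (obj G l)" "q = day_el F G Z k l v a b" by blast
    with smash_el_in[OF *(2,3), of "\<lambda>z. z"] show "q \<in> ?L" unfolding day_el_def by blast
  qed
  finally show ?thesis .
qed

context
  fixes F :: "'a gfunct" and G :: "'b gfunct"
  assumes F: "Gamma_functor F" and G: "Gamma_functor G"
begin

lemma day_el_in:
  assumes "v \<in> pmaps (std (k * l)) (std Z)" "a \<in> car (obj F k)" "b \<in> car (obj G l)"
  shows "day_el F G Z k l v a b \<in> car (obj (F \<and>\<^sub>\<Gamma> G) Z)"
  using assms unfolding car_day by blast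

lemma day_cases:
  assumes "q \<in> car (obj (F \<and>\<^sub>\<Gamma> G) Z)"
  obtains k l v a b where "v \<in> pmaps (std (k * l)) (std Z)" "a \<in> car (obj F k)" "b \<in> car (obj G l)"
    "q = day_el F G Z k l v a b"
  using assms unfolding car_day by blast

lemma day_el_pt:
  assumes "v \<in> pmaps (std (k * l)) (std Z)"
  shows "day_el F G Z k l v (pt (obj F k)) b = pt (obj (F \<and>\<^sub>\<Gamma> G) Z)"
    "day_el F G Z k l v a (pt (obj G l)) = pt (obj (F \<and>\<^sub>\<Gamma> G) Z)"
  using assms colim_cls_pt[of "(k, l, v)" "day_idx Z" "day_diag F G"]
  by (simp_all add: day_el_def day_def)

text \<open>The defining relation of the colimit: \<open>(f, g)\<close> is an index morphism to
  \<open>(k', l', v)\<close> from the index whose map is \<open>v\<close> after the smash of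
  \<open>f\<close> and \<open>g\<close>. Read from left to right it moves \<open>f\<close> and
  \<open>g\<close> from the elements to the index map.\<close>

lemma day_el_mor:
  assumes "f \<in> pmaps (std k) (std k')" "g \<in> pmaps (std l) (std l')" "v \<in> pmaps (std (k' * l')) (std Z)"
    "a \<in> car (obj F k)" "b \<in> car (obj G l)"
  shows "day_el F G Z k' l' v (mor F k k' f a) (mor G l l' g b)
    = day_el F G Z k l (compose {0..k * l} v (nsmash k l l' f g)) a b"
proof -
  let ?v = "compose {0..k * l} v (nsmash k l l' f g)"
  have v: "?v \<in> pmaps (std (k * l)) (std Z)"
    by (rule std_compose[OF nsmash_pmaps[OF assms(1,2)] assms(3)])
  have "mor (day_diag F G) (k, l, ?v) (k', l', v) (f, g) (smash_el (\<lambda>z. z) (obj F k) (obj G l) a b)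
    = smash_el (\<lambda>z. z) (obj F k') (obj G l') (mor F k k' f a) (mor G l l' g b)"
    using assms F G by (simp add: day_diag_def smash_map_el Gamma_functor_mor Gamma_functor_pt)
  then show ?thesis
    using colim_cls_mor[of "(k, l, ?v)" "day_idx Z" "(k', l', v)" "(f, g)"
        "smash_el (\<lambda>z. z) (obj F k) (obj G l) a b" "day_diag F G"] assms v
      smash_el_in[OF assms(4,5), of "\<lambda>z. z"]
    by (simp add: day_el_def)
qed

text \<open>Here \<open>c\<close> is the family as it occurs in a definition, on encoded smash
  elements, and \<open>h\<close> is its expression in coordinates. The hypothesis \<open>mor\<close>
  gives the cocone condition, and \<open>pt\<close> gives the common value at the base points, each
  of which is the smash of two base points.\<close>

lemma day_desc_el:
  assumes v: "v \<in> pmaps (std (k * l)) (std Z)" and a: "a \<in> car (obj F k)" and b: "b \<in> car (obj G l)"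
    and c: "\<And>k l v a b. \<lbrakk>v \<in> pmaps (std (k * l)) (std Z); a \<in> car (obj F k); b \<in> car (obj G l)\<rbrakk>
      \<Longrightarrow> c k l v (smash_el (\<lambda>z. z) (obj F k) (obj G l) a b) = h k l v a b"
    and pt: "\<And>k l v b. \<lbrakk>v \<in> pmaps (std (k * l)) (std Z); b \<in> car (obj G l)\<rbrakk>
      \<Longrightarrow> h k l v (pt (obj F k)) b = p"
    and mor: "\<And>k l k' l' f g v a b. \<lbrakk>f \<in> pmaps (std k) (std k'); g \<in> pmaps (std l) (std l');
        v \<in> pmaps (std (k' * l')) (std Z); a \<in> car (obj F k); b \<in> car (obj G l)\<rbrakk>
      \<Longrightarrow> h k' l' v (mor F k k' f a) (mor G l l' g b)
        = h k l (compose {0..k * l} v (nsmash k l l' f g)) a b"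
  shows "day_desc F G Z c (day_el F G Z k l v a b) = h k l v a b"
proof -
  let ?el = "smash_el (\<lambda>z. z) (obj F k) (obj G l) a b"
  have "day_desc F G Z c (colim_cls (day_idx Z) (day_diag F G) (k, l, v) ?el)
    = (\<lambda>(k, l, v). c k l v) (k, l, v) ?el"
  proof (rule colim_desc_cls[where b = p])
    fix i j m x
    assume i: "i \<in> Ob (day_idx Z)" and j: "j \<in> Ob (day_idx Z)" and m: "m \<in> Hom (day_idx Z) i j"
      and x: "x \<in> car (obj (day_diag F G) i)"
    obtain k l v k' l' v' f g where eq: "i = (k, l, v)" "j = (k', l', v')" "m = (f, g)"
      by (metis prod.exhaust)
    have fg: "f \<in> pmaps (std k) (std k')" "g \<in> pmaps (std l) (std l')"
      "v = compose {0..k * l} v' (nsmash k l l' f g)"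
      "v' \<in> pmaps (std (k' * l')) (std Z)" "v \<in> pmaps (std (k * l)) (std Z)"
      using i j m by (auto simp: eq)
    from x obtain a b where ab: "a \<in> car (obj F k)" "b \<in> car (obj G l)"
      "x = smash_el (\<lambda>z. z) (obj F k) (obj G l) a b"
      by (auto simp: eq elim!: smash_cases)
    have "mor (day_diag F G) i j m x
      = smash_el (\<lambda>z. z) (obj F k') (obj G l') (mor F k k' f a) (mor G l l' g b)"
      using fg ab F G by (simp add: eq day_diag_def smash_map_el Gamma_functor_mor Gamma_functor_pt)
    moreover have "mor F k k' f a \<in> car (obj F k')" "mor G l l' g b \<in> car (obj G l')"
      using fg ab pmaps_in[OF Gamma_functor_mor] F G by auto
    ultimately show "(\<lambda>(k, l, v). c k l v) j (mor (day_diag F G) i j m x) = (\<lambda>(k, l, v). c k l v) i x"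
      using c[OF fg(4)] c[OF fg(5) ab(1,2)] mor[OF fg(1,2,4) ab(1,2)] ab(3) fg(3)
      by (simp add: eq)
  next
    fix i assume "i \<in> Ob (day_idx Z)"
    then obtain k l v where i: "i = (k, l, v)" "v \<in> pmaps (std (k * l)) (std Z)"
      by (metis prod.exhaust day_idx_Ob)
    then show "(\<lambda>(k, l, v). c k l v) i (pt (obj (day_diag F G) i)) = p"
      using c[OF i(2) Gamma_functor_pt Gamma_functor_pt] pt[OF i(2) Gamma_functor_pt] F G
      by simp
  qed (use v a b in \<open>simp_all add: smash_el_in\<close>)
  then show ?thesis using c[OF v a b] by (simp add: day_el_def)
qed

lemma day_mor_el:
  assumes w: "w \<in> pmaps (std Z) (std Z')" and v: "v \<in> pmaps (std (k * l)) (std Z)"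
    and a: "a \<in> car (obj F k)" and b: "b \<in> car (obj G l)"
  shows "mor (F \<and>\<^sub>\<Gamma> G) Z Z' w (day_el F G Z k l v a b)
    = day_el F G Z' k l (compose {0..k * l} w v) a b"
proof -
  have "day_desc F G Z (\<lambda>k l v. day_cls F G Z' k l (compose {0..k * l} w v)) (day_el F G Z k l v a b)
    = day_el F G Z' k l (compose {0..k * l} w v) a b"
  proof (rule day_desc_el[OF v a b, where p = "pt (obj (F \<and>\<^sub>\<Gamma> G) Z')"])
    fix k l k' l' f g v a b
    assume *: "f \<in> pmaps (std k) (std k')" "g \<in> pmaps (std l) (std l')"
      "v \<in> pmaps (std (k' * l')) (std Z)" "a \<in> car (obj F k)" "b \<in> car (obj G l)"
    have "compose {0..k * l} (compose {0..k' * l'} w v) (nsmash k l l' f g)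
      = compose {0..k * l} w (compose {0..k * l} v (nsmash k l l' f g))"
      using nsmash_pmaps[OF *(1,2)] by (simp add: compose_assoc[symmetric] pmaps_def PiE_def)
    then show "day_el F G Z' k' l' (compose {0..k' * l'} w v) (mor F k k' f a) (mor G l l' g b)
      = day_el F G Z' k l (compose {0..k * l} w (compose {0..k * l} v (nsmash k l l' f g))) a b"
      using day_el_mor[OF *(1,2) std_compose[OF *(3) w] *(4,5)] by simp
  qed (simp_all add: day_el_def[symmetric] day_el_pt std_compose[OF _ w])
  then show ?thesis by (simp add: day_def)
qed

lemma day_pt_in: "pt (obj (F \<and>\<^sub>\<Gamma> G) Z) \<in> car (obj (F \<and>\<^sub>\<Gamma> G) Z)"
proof -
  \<comment> \<open>The constant map on the smash of \<open>std 0\<close> with itself is an index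
    over every \<open>Z\<close>; it provides a representative of the base point.\<close>
  have "(\<lambda>i\<in>{0..0}. 0) \<in> pmaps (std (0 * 0)) (std Z)" by (auto simp: pmaps_def)
  from day_el_in[OF this Gamma_functor_pt[OF F] Gamma_functor_pt[OF G]] day_el_pt(1)[OF this]
  show ?thesis by simp
qed

text \<open>Lets convolutions be iterated: the lemmas of this context then apply with a convolution
  in either argument.\<close>

lemma day_functor: "Gamma_functor (F \<and>\<^sub>\<Gamma> G)"
proof (rule Gamma_functorI)
  fix Z Z' w assume w: "w \<in> pmaps (std Z) (std Z')"
  show "mor (F \<and>\<^sub>\<Gamma> G) Z Z' w \<in> pmaps (obj (F \<and>\<^sub>\<Gamma> G) Z) (obj (F \<and>\<^sub>\<Gamma> G) Z')"
  proof (rule pmapsI)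
    fix q assume "q \<in> car (obj (F \<and>\<^sub>\<Gamma> G) Z)"
    then show "mor (F \<and>\<^sub>\<Gamma> G) Z Z' w q \<in> car (obj (F \<and>\<^sub>\<Gamma> G) Z')"
      by (elim day_cases) (simp add: day_mor_el[OF w] day_el_in std_compose[OF _ w])
  next
    show "mor (F \<and>\<^sub>\<Gamma> G) Z Z' w \<in> extensional (car (obj (F \<and>\<^sub>\<Gamma> G) Z))"
      by (simp add: day_def colim_desc_def)
  next
    have v: "(\<lambda>i\<in>{0..0}. 0) \<in> pmaps (std (0 * 0)) (std Z)" by (auto simp: pmaps_def)
    show "mor (F \<and>\<^sub>\<Gamma> G) Z Z' w (pt (obj (F \<and>\<^sub>\<Gamma> G) Z)) = pt (obj (F \<and>\<^sub>\<Gamma> G) Z')"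
      using day_mor_el[OF w v Gamma_functor_pt[OF F] Gamma_functor_pt[OF G]]
        day_el_pt(1)[OF v] day_el_pt(1)[OF std_compose[OF v w]] by simp
  qed
next
  fix Z q assume "q \<in> car (obj (F \<and>\<^sub>\<Gamma> G) Z)"
  then obtain k l v a b where *: "v \<in> pmaps (std (k * l)) (std Z)" "a \<in> car (obj F k)"
    "b \<in> car (obj G l)" "q = day_el F G Z k l v a b" by (rule day_cases)
  have "compose {0..k * l} (\<lambda>i\<in>{0..Z}. i) v = v"
    by (rule std_id_compose[OF *(1)])
  then show "mor (F \<and>\<^sub>\<Gamma> G) Z Z (\<lambda>i\<in>{0..Z}. i) q = q"
    using day_mor_el[OF std_id *(1-3)] *(4) by simp
next
  fix Y Z W f g q
  assume fg: "f \<in> pmaps (std Y) (std Z)" "g \<in> pmaps (std Z) (std W)" and "q \<in> car (obj (F \<and>\<^sub>\<Gamma> G) Y)"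
  from this(3) obtain k l v a b where *: "v \<in> pmaps (std (k * l)) (std Y)" "a \<in> car (obj F k)"
    "b \<in> car (obj G l)" "q = day_el F G Y k l v a b" by (rule day_cases)
  have "compose {0..k * l} (compose {0..Y} g f) v = compose {0..k * l} g (compose {0..k * l} f v)"
    using *(1) by (simp add: compose_assoc[symmetric] pmaps_def PiE_def)
  then show "mor (F \<and>\<^sub>\<Gamma> G) Y W (compose {0..Y} g f) q = mor (F \<and>\<^sub>\<Gamma> G) Z W g (mor (F \<and>\<^sub>\<Gamma> G) Y Z f q)"
    using * fg by (simp add: day_mor_el std_compose)
qed (rule day_pt_in)

text \<open>The universal property of Day convolution on elements. Applying \<open>mor H\<close> at
  \<open>v\<close> to the naturality square of \<open>h\<close> yields the cocone condition of
  \<open>day_desc_el\<close>, by functoriality of \<open>H\<close>.\<close>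

lemma day_lift_el:
  assumes H: "Gamma_functor H"
    and v: "v \<in> pmaps (std (k * l)) (std Z)" and a: "a \<in> car (obj F k)" and b: "b \<in> car (obj G l)"
    and in_H: "\<And>k l a b. \<lbrakk>a \<in> car (obj F k); b \<in> car (obj G l)\<rbrakk> \<Longrightarrow> h k l a b \<in> car (obj H (k * l))"
    and c: "\<And>k l a b. \<lbrakk>a \<in> car (obj F k); b \<in> car (obj G l)\<rbrakk>
      \<Longrightarrow> \<phi> k l (smash_el (\<lambda>z. z) (obj F k) (obj G l) a b) = h k l a b"
    and pt: "\<And>k l b. b \<in> car (obj G l) \<Longrightarrow> h k l (pt (obj F k)) b = pt (obj H (k * l))"
    and nat: "\<And>k l k' l' f g a b. \<lbrakk>f \<in> pmaps (std k) (std k'); g \<in> pmaps (std l) (std l');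
        a \<in> car (obj F k); b \<in> car (obj G l)\<rbrakk>
      \<Longrightarrow> h k' l' (mor F k k' f a) (mor G l l' g b)
        = mor H (k * l) (k' * l') (nsmash k l l' f g) (h k l a b)"
  shows "day_lift F G H \<phi> Z (day_el F G Z k l v a b) = mor H (k * l) Z v (h k l a b)"
  unfolding day_lift_def
proof (rule day_desc_el[OF v a b, where p = "pt (obj H Z)"])
  fix k l k' l' f g v a b
  assume *: "f \<in> pmaps (std k) (std k')" "g \<in> pmaps (std l) (std l')"
    "v \<in> pmaps (std (k' * l')) (std Z)" "a \<in> car (obj F k)" "b \<in> car (obj G l)"
  then show "mor H (k' * l') Z v (h k' l' (mor F k k' f a) (mor G l l' g b))
    = mor H (k * l) Z (compose {0..k * l} v (nsmash k l l' f g)) (h k l a b)"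
    by (simp add: nat Gamma_functor_comp[OF H nsmash_pmaps] in_H)
qed (simp_all add: c pt pmaps_pt[OF Gamma_functor_mor[OF H]])

end

text \<open>Naturality of \<phi> and \<psi> carries the relation \<open>day_el_mor\<close> of the
  source to that of the target, so the formula is constant on classes.\<close>

lemma day_map_el:
  assumes F: "Gamma_functor F" and G: "Gamma_functor G" and F': "Gamma_functor F'" and G': "Gamma_functor G'"
    and \<phi>: "Gamma_hom F F' \<phi>" and \<psi>: "Gamma_hom G G' \<psi>"
    and v: "v \<in> pmaps (std (k * l)) (std Z)" and a: "a \<in> car (obj F k)" and b: "b \<in> car (obj G l)"
  shows "day_map F G F' G' \<phi> \<psi> Z (day_el F G Z k l v a b) = day_el F' G' Z k l v (\<phi> k a) (\<psi> l b)"
  unfolding day_map_def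
proof (rule day_desc_el[OF F G v a b, where p = "pt (obj (F' \<and>\<^sub>\<Gamma> G') Z)"])
  have \<phi>': "\<phi> k \<in> pmaps (obj F k) (obj F' k)" and \<psi>': "\<psi> k \<in> pmaps (obj G k) (obj G' k)" for k
    using \<phi> \<psi> by (simp_all add: Gamma_hom_def)
  fix k l v a b assume *: "v \<in> pmaps (std (k * l)) (std Z)" "b \<in> car (obj G l)"
  then show "day_el F' G' Z k l v (\<phi> k (pt (obj F k))) (\<psi> l b) = pt (obj (F' \<and>\<^sub>\<Gamma> G') Z)"
    by (simp add: pmaps_pt[OF \<phi>'] day_el_pt[OF F' G'])
  assume "a \<in> car (obj F k)"
  with * show "day_cls F' G' Z k l v (smash_map (obj F k) (obj G l) (obj F' k) (obj G' l) (\<phi> k) (\<psi> l)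
      (smash_el (\<lambda>z. z) (obj F k) (obj G l) a b)) = day_el F' G' Z k l v (\<phi> k a) (\<psi> l b)"
    by (simp add: day_el_def smash_map_el[OF \<phi>' \<psi>'] Gamma_functor_pt F G)
next
  fix k l k' l' f g v a b
  assume *: "f \<in> pmaps (std k) (std k')" "g \<in> pmaps (std l) (std l')"
    "v \<in> pmaps (std (k' * l')) (std Z)" "a \<in> car (obj F k)" "b \<in> car (obj G l)"
  have "compose (car (obj F k)) (\<phi> k') (mor F k k' f) a = compose (car (obj F k)) (mor F' k k' f) (\<phi> k) a"
    "compose (car (obj G l)) (\<psi> l') (mor G l l' g) b = compose (car (obj G l)) (mor G' l l' g) (\<psi> l) b"
    using \<phi> \<psi> *(1,2) by (simp_all add: Gamma_hom_def)
  then have "\<phi> k' (mor F k k' f a) = mor F' k k' f (\<phi> k a)"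
    "\<psi> l' (mor G l l' g b) = mor G' l l' g (\<psi> l b)"
    using * by (simp_all add: compose_eq)
  moreover have "\<phi> k a \<in> car (obj F' k)" "\<psi> l b \<in> car (obj G' l)"
    using * \<phi> \<psi> by (auto simp: Gamma_hom_def intro: pmaps_in)
  ultimately show "day_el F' G' Z k' l' v (\<phi> k' (mor F k k' f a)) (\<psi> l' (mor G l l' g b))
    = day_el F' G' Z k l (compose {0..k * l} v (nsmash k l l' f g)) (\<phi> k a) (\<psi> l b)"
    using day_el_mor[OF F' G' *(1-3)] by simp
qed

section \<open>\<open>\<S>\<close>-algebras from external products\<close>

lemma S_functor: "Gamma_functor \<S>"
  by (rule Gamma_functorI) (simp_all add: \<S>_def compose_eq)

lemma Gamma_hom_id: "Gamma_functor F \<Longrightarrow> Gamma_hom F F (Gamma_id F)"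
  unfolding Gamma_hom_def Gamma_id_def
  by (auto simp: pmaps_def[of "obj F _" "obj F _"] Gamma_functor_pt compose_def fun_eq_iff
      dest: Gamma_functor_mor intro: pmaps_in)

lemma Gamma_comp_cong:
  "(\<And>Z q. q \<in> car (obj F Z) \<Longrightarrow> \<psi> Z (\<phi> Z q) = \<psi>' Z (\<phi>' Z q))
    \<Longrightarrow> Gamma_comp F \<psi> \<phi> = Gamma_comp F \<psi>' \<phi>'"
  by (auto simp: Gamma_comp_def compose_def fun_eq_iff)

lemma Gamma_comp_eqI:
  assumes "\<And>Z. \<chi> Z \<in> extensional (car (obj F Z))"
    and "\<And>Z q. q \<in> car (obj F Z) \<Longrightarrow> \<psi> Z (\<phi> Z q) = \<chi> Z q"
  shows "Gamma_comp F \<psi> \<phi> = \<chi>"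
proof
  fix Z show "Gamma_comp F \<psi> \<phi> Z = \<chi> Z"
    by (rule extensionalityI[OF _ assms(1)]) (use assms(2) in \<open>simp_all add: Gamma_comp_def compose_eq\<close>)
qed

lemma day_lift_extensional: "day_lift F G H \<phi> Z \<in> extensional (car (obj (F \<and>\<^sub>\<Gamma> G) Z))"
  by (simp add: day_lift_def day_def colim_desc_def)

section \<open>The unit isomorphisms on generators\<close>

lemma nsm_pmaps:
  "i \<le> k \<Longrightarrow> (\<lambda>j\<in>{0..l}. nsm l i j) \<in> pmaps (std l) (std (k * l))"
  "j \<le> l \<Longrightarrow> (\<lambda>i\<in>{0..k}. nsm l i j) \<in> pmaps (std k) (std (k * l))"
  by (auto intro!: pmapsI simp: nsm_le)

lemma nsmash_id: "nsmash k l l (\<lambda>i\<in>{0..k}. i) (\<lambda>j\<in>{0..l}. j) = (\<lambda>i\<in>{0..k * l}. i)"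
  by (rule nsm_ext[where k = k and l = l]) (simp_all add: nsmash_nsm[OF std_id std_id] nsm_le)

text \<open>Naturality of the inclusions of rows; it yields the naturality of the left unit map here
  and of \<open>row\<close> later.\<close>

lemma nsmash_nsm_row:
  assumes f: "f \<in> pmaps (std k) (std k')" and g: "g \<in> pmaps (std l) (std l')" and "i \<le> k"
  shows "compose {0..l} (nsmash k l l' f g) (\<lambda>j\<in>{0..l}. nsm l i j)
    = compose {0..l} (\<lambda>j\<in>{0..l'}. nsm l' (f i) j) g"
  using assms(3) nsmash_nsm[OF f g] pmaps_in[OF g] by (auto simp: compose_def fun_eq_iff)

lemma nsmash_nsm_column:
  assumes f: "f \<in> pmaps (std k) (std k')" and g: "g \<in> pmaps (std l) (std l')" and "j \<le> l"
  shows "compose {0..k} (nsmash k l l' f g) (\<lambda>i\<in>{0..k}. nsm l i j)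
    = compose {0..k} (\<lambda>i\<in>{0..k'}. nsm l' i (g j)) f"
  using assms(3) nsmash_nsm[OF f g] pmaps_in[OF f] by (auto simp: compose_def fun_eq_iff)

text \<open>The constant map factors through \<open>std 0\<close>, where \<open>F\<close> has only
  the base point.\<close>

lemma Gamma_set_const:
  assumes F: "Gamma_set F" and a: "a \<in> car (obj F k)"
  shows "mor F k l (\<lambda>i\<in>{0..k}. 0) a = pt (obj F l)"
proof -
  have F': "Gamma_functor F" and F0: "car (obj F 0) = {pt (obj F 0)}"
    using F by (simp_all add: Gamma_set_def)
  have f: "(\<lambda>i\<in>{0..k}. 0) \<in> pmaps (std k) (std 0)" and g: "(\<lambda>i\<in>{0..0}. 0) \<in> pmaps (std 0) (std l)"
    by (auto intro!: pmapsI)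
  have "compose {0..k} (\<lambda>i\<in>{0..0}. 0) (\<lambda>i\<in>{0..k}. 0 :: nat) = (\<lambda>i\<in>{0..k}. 0 :: nat)"
    by (auto simp: compose_def fun_eq_iff)
  moreover have "mor F k 0 (\<lambda>i\<in>{0..k}. 0) a = pt (obj F 0)"
    using pmaps_in[OF Gamma_functor_mor[OF F' f] a] F0 by simp
  ultimately show ?thesis
    using Gamma_functor_comp[OF F' f g a] pmaps_pt[OF Gamma_functor_mor[OF F' g]] by simp
qed

lemma day_lunit_el:
  assumes G: "Gamma_set G"
    and v: "v \<in> pmaps (std (k * l)) (std Z)" and i: "i \<le> k" and b: "b \<in> car (obj G l)"
  shows "day_lunit G Z (day_el \<S> G Z k l v i b)
    = mor G (k * l) Z v (mor G l (k * l) (\<lambda>j\<in>{0..l}. nsm l i j) b)"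
proof -
  have G': "Gamma_functor G" using G by (simp add: Gamma_set_def)
  show ?thesis
    unfolding day_lunit_def
  proof (rule day_lift_el[OF S_functor G' G' v])
    fix k l i b assume "i \<in> car (obj \<S> k)" and b: "b \<in> car (obj G l)"
    then have i: "i \<le> k" by (simp add: \<S>_def)
    show "mor G l (k * l) (\<lambda>j\<in>{0..l}. nsm l i j) b \<in> car (obj G (k * l))"
      by (rule pmaps_in[OF Gamma_functor_mor[OF G' nsm_pmaps(1)[OF i]] b])
    show "smash_fun (\<lambda>z. z) (std k) (obj G l) (\<lambda>i b. mor G l (k * l) (\<lambda>j\<in>{0..l}. nsm l i j) b)
        (smash_el (\<lambda>z. z) (obj \<S> k) (obj G l) i b) = mor G l (k * l) (\<lambda>j\<in>{0..l}. nsm l i j) b"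
      using smash_fun_el[of "\<lambda>z. z" i "std k" b "obj G l"
          "\<lambda>i b. mor G l (k * l) (\<lambda>j\<in>{0..l}. nsm l i j) b" "pt (obj G (k * l))"] i b
        pmaps_pt[OF Gamma_functor_mor[OF G' nsm_pmaps(1)]]
      by (simp add: \<S>_def Gamma_set_const[OF G] Gamma_functor_pt[OF G'])
    fix k' l' f g
    assume fg: "f \<in> pmaps (std k) (std k')" "g \<in> pmaps (std l) (std l')"
    have "f i \<le> k'" using pmaps_in[OF fg(1), of i] i by simp
    then show "mor G l' (k' * l') (\<lambda>j\<in>{0..l'}. nsm l' (mor \<S> k k' f i) j) (mor G l l' g b)
      = mor G (k * l) (k' * l') (nsmash k l l' f g) (mor G l (k * l) (\<lambda>j\<in>{0..l}. nsm l i j) b)"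
      using fg i b nsmash_nsm_row[OF fg i]
      by (simp add: \<S>_def Gamma_functor_comp[OF G'] nsm_pmaps nsmash_pmaps)
  next
    fix k l b assume b: "b \<in> car (obj G l)"
    \<comment> \<open>The base point of \<open>std k\<close> acts through a constant inclusion,
      which \<open>Gamma_set_const\<close> sends to the base point.\<close>
    have "(\<lambda>j\<in>{0..l}. nsm l 0 j) = (\<lambda>j\<in>{0..l}. 0)" by (simp add: fun_eq_iff)
    then show "mor G l (k * l) (\<lambda>j\<in>{0..l}. nsm l (pt (obj \<S> k)) j) b = pt (obj G (k * l))"
      using Gamma_set_const[OF G b] by (simp only: \<S>_def funct.simps pt_std)
  qed (use i b in \<open>simp_all add: \<S>_def\<close>)
qed

lemma day_runit_el:
  assumes F: "Gamma_set F"
    and v: "v \<in> pmaps (std (k * l)) (std Z)" and a: "a \<in> car (obj F k)" and j: "j \<le> l"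
  shows "day_runit F Z (day_el F \<S> Z k l v a j)
    = mor F (k * l) Z v (mor F k (k * l) (\<lambda>i\<in>{0..k}. nsm l i j) a)"
proof -
  have F': "Gamma_functor F" using F by (simp add: Gamma_set_def)
  show ?thesis
    unfolding day_runit_def
  proof (rule day_lift_el[OF F' S_functor F' v])
    fix k l a j assume a: "a \<in> car (obj F k)" and "j \<in> car (obj \<S> l)"
    then have j: "j \<le> l" by (simp add: \<S>_def)
    show "mor F k (k * l) (\<lambda>i\<in>{0..k}. nsm l i j) a \<in> car (obj F (k * l))"
      by (rule pmaps_in[OF Gamma_functor_mor[OF F' nsm_pmaps(2)[OF j]] a])
    show "smash_fun (\<lambda>z. z) (obj F k) (std l) (\<lambda>a j. mor F k (k * l) (\<lambda>i\<in>{0..k}. nsm l i j) a)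
        (smash_el (\<lambda>z. z) (obj F k) (obj \<S> l) a j) = mor F k (k * l) (\<lambda>i\<in>{0..k}. nsm l i j) a"
      using smash_fun_el[of "\<lambda>z. z" a "obj F k" j "std l"
          "\<lambda>a j. mor F k (k * l) (\<lambda>i\<in>{0..k}. nsm l i j) a" "pt (obj F (k * l))"] j a
        pmaps_pt[OF Gamma_functor_mor[OF F' nsm_pmaps(2)]]
      by (simp add: \<S>_def Gamma_set_const[OF F] Gamma_functor_pt[OF F'])
    fix k' l' f g
    assume fg: "f \<in> pmaps (std k) (std k')" "g \<in> pmaps (std l) (std l')"
    have "g j \<le> l'" using pmaps_in[OF fg(2), of j] j by simp
    then show "mor F k' (k' * l') (\<lambda>i\<in>{0..k'}. nsm l' i (mor \<S> l l' g j)) (mor F k k' f a)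
      = mor F (k * l) (k' * l') (nsmash k l l' f g) (mor F k (k * l) (\<lambda>i\<in>{0..k}. nsm l i j) a)"
      using fg j a nsmash_nsm_column[OF fg j]
      by (simp add: \<S>_def Gamma_functor_comp[OF F'] nsm_pmaps nsmash_pmaps)
  next
    fix k l j assume "j \<in> car (obj \<S> l)"
    then have "j \<le> l" by (simp add: \<S>_def)
    then show "mor F k (k * l) (\<lambda>i\<in>{0..k}. nsm l i j) (pt (obj F k)) = pt (obj F (k * l))"
      by (rule pmaps_pt[OF Gamma_functor_mor[OF F' nsm_pmaps(2)]])
  qed (use j a in \<open>simp_all add: \<S>_def\<close>)
qed

section \<open>The associativity isomorphism on generators\<close>

context
  fixes F :: "'a gfunct" and G :: "'b gfunct" and H :: "'c gfunct"
  assumes F: "Gamma_functor F" and G: "Gamma_functor G" and H: "Gamma_functor H"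
begin

text \<open>The value of the inner family of \<open>day_assoc\<close> on generators. It lives over
  \<open>m * n\<close> and not over \<open>Z\<close>, since \<open>day_lift\<close> applies
  \<open>v\<close> only afterwards.\<close>

definition assoc_el where
  "assoc_el m n k l w a b c = day_el F (G \<and>\<^sub>\<Gamma> H) (m * n) k (l * n)
     (nsmash (k * l) n n w (\<lambda>j\<in>{0..n}. j)) a (day_el G H (l * n) l n (\<lambda>j\<in>{0..l * n}. j) b c)"

private lemma nsmash_id_pmaps:
  "w \<in> pmaps (std (k * l)) (std m)
    \<Longrightarrow> nsmash (k * l) n n w (\<lambda>j\<in>{0..n}. j) \<in> pmaps (std (k * (l * n))) (std (m * n))"
  using nsmash_pmaps[OF _ std_id, of w "k * l" m n] by (simp add: mult.assoc)

private lemma assoc_el_in: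
  "\<lbrakk>w \<in> pmaps (std (k * l)) (std m); a \<in> car (obj F k); b \<in> car (obj G l); c \<in> car (obj H n)\<rbrakk>
    \<Longrightarrow> assoc_el m n k l w a b c \<in> car (obj (F \<and>\<^sub>\<Gamma> G \<and>\<^sub>\<Gamma> H) (m * n))"
  unfolding assoc_el_def
  by (intro day_el_in F G H day_functor nsmash_id_pmaps std_id) auto

private lemma assoc_el_pt:
  assumes w: "w \<in> pmaps (std (k * l)) (std m)"
  shows "assoc_el m n k l w (pt (obj F k)) b c = pt (obj (F \<and>\<^sub>\<Gamma> G \<and>\<^sub>\<Gamma> H) (m * n))"
    "assoc_el m n k l w a (pt (obj G l)) c = pt (obj (F \<and>\<^sub>\<Gamma> G \<and>\<^sub>\<Gamma> H) (m * n))"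
    "assoc_el m n k l w a b (pt (obj H n)) = pt (obj (F \<and>\<^sub>\<Gamma> G \<and>\<^sub>\<Gamma> H) (m * n))"
  unfolding assoc_el_def
  by (simp_all add: day_el_pt[OF F day_functor[OF G H] nsmash_id_pmaps[OF w]]
      day_el_pt[OF G H std_id])

text \<open>One naturality statement in three variables with two uses: with \<open>h\<close> an
  identity it shows that the inner description is constant on classes, with \<open>f\<close> and
  \<open>g\<close> identities it gives naturality in the last factor.\<close>

private lemma assoc_el_mor:
  assumes f: "f \<in> pmaps (std k) (std k')" and g: "g \<in> pmaps (std l) (std l')"
    and h: "h \<in> pmaps (std n) (std n')" and w: "w \<in> pmaps (std (k' * l')) (std m)"
    and a: "a \<in> car (obj F k)" and b: "b \<in> car (obj G l)" and c: "c \<in> car (obj H n)"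
  shows "assoc_el m n' k' l' w (mor F k k' f a) (mor G l l' g b) (mor H n n' h c)
    = day_el F (G \<and>\<^sub>\<Gamma> H) (m * n') k (l * n)
        (nsmash (k * l) n n' (compose {0..k * l} w (nsmash k l l' f g)) h) a
        (day_el G H (l * n) l n (\<lambda>j\<in>{0..l * n}. j) b c)"
proof -
  let ?e = "day_el G H (l * n) l n (\<lambda>j\<in>{0..l * n}. j) b c"
  have gh: "nsmash l n n' g h \<in> pmaps (std (l * n)) (std (l' * n'))"
    by (rule nsmash_pmaps[OF g h])
  have e: "?e \<in> car (obj (G \<and>\<^sub>\<Gamma> H) (l * n))" by (rule day_el_in[OF G H std_id b c])
  have "compose {0..l * n} (\<lambda>j\<in>{0..l' * n'}. j) (nsmash l n n' g h) = nsmash l n n' g h"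
    "compose {0..l * n} (nsmash l n n' g h) (\<lambda>j\<in>{0..l * n}. j) = nsmash l n n' g h"
    by (rule std_id_compose[OF gh], rule std_compose_id[OF gh])
  \<comment> \<open>The smash of \<open>g\<close> and \<open>h\<close> passes from the elements to
    the index map by \<open>day_el_mor\<close>, and from there to the outside by
    \<open>day_mor_el\<close>. It then counts as a morphism in the second factor of the outer
    convolution.\<close>
  then have "day_el G H (l' * n') l' n' (\<lambda>j\<in>{0..l' * n'}. j) (mor G l l' g b) (mor H n n' h c)
    = mor (G \<and>\<^sub>\<Gamma> H) (l * n) (l' * n') (nsmash l n n' g h) ?e"
    using day_el_mor[OF G H g h std_id b c] day_mor_el[OF G H gh std_id b c] by simp
  then have "assoc_el m n' k' l' w (mor F k k' f a) (mor G l l' g b) (mor H n n' h c)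
    = day_el F (G \<and>\<^sub>\<Gamma> H) (m * n') k (l * n) (compose {0..k * (l * n)}
       (nsmash (k' * l') n' n' w (\<lambda>j\<in>{0..n'}. j)) (nsmash k (l * n) (l' * n') f (nsmash l n n' g h))) a ?e"
    unfolding assoc_el_def using day_el_mor[OF F day_functor[OF G H] f gh nsmash_id_pmaps[OF w] a e]
    by simp
  also have "compose {0..k * (l * n)}
       (nsmash (k' * l') n' n' w (\<lambda>j\<in>{0..n'}. j)) (nsmash k (l * n) (l' * n') f (nsmash l n n' g h))
    = nsmash (k * l) n n' (compose {0..k * l} w (nsmash k l l' f g)) (compose {0..n} (\<lambda>j\<in>{0..n'}. j) h)"
    using nsmash_compose[OF nsmash_pmaps[OF f g] w h std_id] nsmash_assoc[OF f g h]
    by (simp add: mult.assoc)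
  also have "compose {0..n} (\<lambda>j\<in>{0..n'}. j) h = h"
    by (rule std_id_compose[OF h])
  finally show ?thesis .
qed

text \<open>The left hand side is the term in the definition of \<open>day_assoc\<close>.\<close>

private lemma assoc_el_desc:
  assumes w: "w \<in> pmaps (std (k * l)) (std m)"
    and a: "a \<in> car (obj F k)" and b: "b \<in> car (obj G l)" and c: "c \<in> car (obj H n)"
  shows "day_desc F G m (\<lambda>k l w (a, b).
          day_cls F (G \<and>\<^sub>\<Gamma> H) (m * n) k (l * n) (nsmash (k * l) n n w (\<lambda>j\<in>{0..n}. j))
            (smash_el (\<lambda>z. z) (obj F k) (obj (G \<and>\<^sub>\<Gamma> H) (l * n)) a
              (day_cls G H (l * n) l n (\<lambda>j\<in>{0..l * n}. j)
                (smash_el (\<lambda>z. z) (obj G l) (obj H n) b c)))) (day_el F G m k l w a b)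
    = assoc_el m n k l w a b c"
  unfolding day_el_def[of G H, symmetric] day_el_def[of F "G \<and>\<^sub>\<Gamma> H", symmetric] assoc_el_def[symmetric]
proof (rule day_desc_el[OF F G w a b, where p = "pt (obj (F \<and>\<^sub>\<Gamma> G \<and>\<^sub>\<Gamma> H) (m * n))"])
  fix k l w a b assume "w \<in> pmaps (std (k * l)) (std m)"
  then show "(\<lambda>(a, b). assoc_el m n k l w a b c) (smash_el (\<lambda>z. z) (obj F k) (obj G l) a b)
    = assoc_el m n k l w a b c"
    by (auto simp: smash_el_def assoc_el_pt)
next
  fix k l k' l' f g w a b
  assume *: "f \<in> pmaps (std k) (std k')" "g \<in> pmaps (std l) (std l')"
    "w \<in> pmaps (std (k' * l')) (std m)" "a \<in> car (obj F k)" "b \<in> car (obj G l)"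
  show "assoc_el m n k' l' w (mor F k k' f a) (mor G l l' g b) c
    = assoc_el m n k l (compose {0..k * l} w (nsmash k l l' f g)) a b c"
    using assoc_el_mor[OF *(1,2) std_id *(3-5) c] c
    by (simp add: assoc_el_def Gamma_functor_id[OF H])
qed (rule assoc_el_pt)

lemma day_assoc_el:
  assumes v: "v \<in> pmaps (std (m * n)) (std Z)" and w: "w \<in> pmaps (std (k * l)) (std m)"
    and a: "a \<in> car (obj F k)" and b: "b \<in> car (obj G l)" and c: "c \<in> car (obj H n)"
  shows "day_assoc F G H Z (day_el (F \<and>\<^sub>\<Gamma> G) H Z m n v (day_el F G m k l w a b) c)
    = day_el F (G \<and>\<^sub>\<Gamma> H) Z k (l * n)
       (compose {0..k * (l * n)} v (nsmash (k * l) n n w (\<lambda>j\<in>{0..n}. j))) a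
       (day_el G H (l * n) l n (\<lambda>j\<in>{0..l * n}. j) b c)"
proof -
  \<comment> \<open>The inner family of \<open>day_assoc\<close> as a function of an arbitrary class
    \<open>q\<close> and of \<open>c\<close>; it serves as the family \<open>h\<close> of
    \<open>day_lift_el\<close>.\<close>
  define \<Phi> where "\<Phi> m n q c = day_desc F G m (\<lambda>k l w (a, b).
          day_cls F (G \<and>\<^sub>\<Gamma> H) (m * n) k (l * n) (nsmash (k * l) n n w (\<lambda>j\<in>{0..n}. j))
            (smash_el (\<lambda>z. z) (obj F k) (obj (G \<and>\<^sub>\<Gamma> H) (l * n)) a
              (day_cls G H (l * n) l n (\<lambda>j\<in>{0..l * n}. j)
                (smash_el (\<lambda>z. z) (obj G l) (obj H n) b c)))) q" for m n q c
  note FG = day_functor[OF F G] and FGH = day_functor[OF F day_functor[OF G H]]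
  have \<Phi>_el: "\<Phi> m n (day_el F G m k l w a b) c = assoc_el m n k l w a b c"
    if "w \<in> pmaps (std (k * l)) (std m)" "a \<in> car (obj F k)" "b \<in> car (obj G l)" "c \<in> car (obj H n)"
    for m n k l w a b c
    unfolding \<Phi>_def by (rule assoc_el_desc[OF that])
  have \<Phi>_pt1: "\<Phi> m n (pt (obj (F \<and>\<^sub>\<Gamma> G) m)) c = pt (obj (F \<and>\<^sub>\<Gamma> G \<and>\<^sub>\<Gamma> H) (m * n))"
    if "c \<in> car (obj H n)" for m n c
  proof -
    \<comment> \<open>The base point of the convolution is presented by a generator, so that
      \<open>\<Phi>_el\<close> can evaluate it.\<close>
    have w: "(\<lambda>i\<in>{0..0}. 0) \<in> pmaps (std (0 * 0)) (std m)" by (auto simp: pmaps_def)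
    show ?thesis
      using \<Phi>_el[OF w Gamma_functor_pt[OF F] Gamma_functor_pt[OF G] that]
      by (simp only: day_el_pt[OF F G w] assoc_el_pt[OF w])
  qed
  have \<Phi>_pt2: "\<Phi> m n q (pt (obj H n)) = pt (obj (F \<and>\<^sub>\<Gamma> G \<and>\<^sub>\<Gamma> H) (m * n))"
    if "q \<in> car (obj (F \<and>\<^sub>\<Gamma> G) m)" for m n q
    using that by (elim day_cases[OF F G]) (simp add: \<Phi>_el Gamma_functor_pt[OF H] assoc_el_pt)
  have "day_assoc F G H Z (day_el (F \<and>\<^sub>\<Gamma> G) H Z m n v (day_el F G m k l w a b) c)
    = mor (F \<and>\<^sub>\<Gamma> G \<and>\<^sub>\<Gamma> H) (m * n) Z v (\<Phi> m n (day_el F G m k l w a b) c)"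
    unfolding day_assoc_def \<Phi>_def[symmetric]
  proof (rule day_lift_el[OF FG H FGH v day_el_in[OF F G w a b] c])
    fix m n q c assume q: "q \<in> car (obj (F \<and>\<^sub>\<Gamma> G) m)" and c: "c \<in> car (obj H n)"
    show "smash_fun (\<lambda>z. z) (obj (F \<and>\<^sub>\<Gamma> G) m) (obj H n) (\<lambda>q c. \<Phi> m n q c)
        (smash_el (\<lambda>z. z) (obj (F \<and>\<^sub>\<Gamma> G) m) (obj H n) q c) = \<Phi> m n q c"
      by (rule smash_fun_el[where b = "pt (obj (F \<and>\<^sub>\<Gamma> G \<and>\<^sub>\<Gamma> H) (m * n))"])
        (use q c in \<open>simp_all add: \<Phi>_pt1 \<Phi>_pt2 Gamma_functor_pt FG H\<close>)
    obtain k l w a b where *: "w \<in> pmaps (std (k * l)) (std m)" "a \<in> car (obj F k)"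
      "b \<in> car (obj G l)" "q = day_el F G m k l w a b" using q by (rule day_cases[OF F G])
    show "\<Phi> m n q c \<in> car (obj (F \<and>\<^sub>\<Gamma> G \<and>\<^sub>\<Gamma> H) (m * n))"
      using * c by (simp add: \<Phi>_el assoc_el_in)
    fix m' n' f g
    assume fg: "f \<in> pmaps (std m) (std m')" "g \<in> pmaps (std n) (std n')"
    let ?e = "day_el G H (l * n) l n (\<lambda>j\<in>{0..l * n}. j) b c"
    have e: "?e \<in> car (obj (G \<and>\<^sub>\<Gamma> H) (l * n))" by (rule day_el_in[OF G H std_id *(3) c])
    have gc: "mor H n n' g c \<in> car (obj H n')"
      by (rule pmaps_in[OF Gamma_functor_mor[OF H fg(2)] c])
    have "\<Phi> m' n' (mor (F \<and>\<^sub>\<Gamma> G) m m' f q) (mor H n n' g c)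
      = assoc_el m' n' k l (compose {0..k * l} f w) a b (mor H n n' g c)"
      using day_mor_el[OF F G fg(1) *(1-3)] \<Phi>_el[OF std_compose[OF *(1) fg(1)] *(2,3) gc] *(4) by simp
    also have "\<dots> = day_el F (G \<and>\<^sub>\<Gamma> H) (m' * n') k (l * n) (nsmash (k * l) n n' (compose {0..k * l} f w) g) a ?e"
      using assoc_el_mor[OF std_id std_id fg(2) std_compose[OF *(1) fg(1)] *(2,3) c]
        std_compose_id[OF std_compose[OF *(1) fg(1)]] *(2,3)
      by (simp add: Gamma_functor_id[OF F] Gamma_functor_id[OF G] nsmash_id)
    also have "nsmash (k * l) n n' (compose {0..k * l} f w) g
      = compose {0..k * (l * n)} (nsmash m n n' f g) (nsmash (k * l) n n w (\<lambda>j\<in>{0..n}. j))"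
    proof -
      have "compose {0..n} g (\<lambda>j\<in>{0..n}. j) = g"
        by (rule std_compose_id[OF fg(2)])
      then show ?thesis
        using nsmash_compose[OF *(1) fg(1) std_id fg(2)] by (simp add: mult.assoc)
    qed
    also have "day_el F (G \<and>\<^sub>\<Gamma> H) (m' * n') k (l * n) \<dots> a ?e
      = mor (F \<and>\<^sub>\<Gamma> G \<and>\<^sub>\<Gamma> H) (m * n) (m' * n') (nsmash m n n' f g) (\<Phi> m n q c)"
      using day_mor_el[OF F day_functor[OF G H] nsmash_pmaps[OF fg] nsmash_id_pmaps[OF *(1)] *(2) e]
        \<Phi>_el[OF *(1-3) c] *(4) by (simp add: assoc_el_def)
    finally show "\<Phi> m' n' (mor (F \<and>\<^sub>\<Gamma> G) m m' f q) (mor H n n' g c)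
      = mor (F \<and>\<^sub>\<Gamma> G \<and>\<^sub>\<Gamma> H) (m * n) (m' * n') (nsmash m n n' f g) (\<Phi> m n q c)" .
  qed (rule \<Phi>_pt1)
  then show ?thesis
    using \<Phi>_el[OF w a b c] day_mor_el[OF F day_functor[OF G H] v nsmash_id_pmaps[OF w] a
        day_el_in[OF G H std_id b c]]
    by (simp add: assoc_el_def)
qed

end

text \<open>The family \<open>p k l\<close> is the map \<open>A(k\<^sub>+) \<and> A(l\<^sub>+) \<rightarrow> A(k\<^sub>+ \<and> l\<^sub>+)\<close> that corresponds to \<open>m\<close>, written
  as a function on the product \<open>A(k\<^sub>+) \<times> A(l\<^sub>+)\<close>. That it vanishes at the base point
  of \<open>A(l\<^sub>+)\<close> as well follows from \<open>m_el\<close>.\<close>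

locale external_product =
  fixes A :: "'a gfunct" and p :: "nat \<Rightarrow> nat \<Rightarrow> 'a \<Rightarrow> 'a \<Rightarrow> 'a" and u :: "nat \<Rightarrow> nat \<Rightarrow> 'a"
    and m :: "nat \<Rightarrow> (day_ob \<times> 'a \<times> 'a) set \<Rightarrow> 'a"
  assumes A: "Gamma_set A"
    and p_in: "\<lbrakk>a \<in> car (obj A k); b \<in> car (obj A l)\<rbrakk> \<Longrightarrow> p k l a b \<in> car (obj A (k * l))"
    and p_pt: "b \<in> car (obj A l) \<Longrightarrow> p k l (pt (obj A k)) b = pt (obj A (k * l))"
    and p_mor: "\<lbrakk>f \<in> pmaps (std k) (std k'); g \<in> pmaps (std l) (std l');
        a \<in> car (obj A k); b \<in> car (obj A l)\<rbrakk>
      \<Longrightarrow> p k' l' (mor A k k' f a) (mor A l l' g b)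
        = mor A (k * l) (k' * l') (nsmash k l l' f g) (p k l a b)"
    and p_assoc: "\<lbrakk>a \<in> car (obj A k); b \<in> car (obj A l); c \<in> car (obj A n)\<rbrakk>
      \<Longrightarrow> p (k * l) n (p k l a b) c = p k (l * n) a (p l n b c)"
    and u: "Gamma_hom \<S> A u"
    and p_unit_left: "\<lbrakk>i \<le> k; b \<in> car (obj A l)\<rbrakk>
      \<Longrightarrow> p k l (u k i) b = mor A l (k * l) (\<lambda>j\<in>{0..l}. nsm l i j) b"
    and p_unit_right: "\<lbrakk>a \<in> car (obj A k); j \<le> l\<rbrakk>
      \<Longrightarrow> p k l a (u l j) = mor A k (k * l) (\<lambda>i\<in>{0..k}. nsm l i j) a"
    and m_extensional: "m Z \<in> extensional (car (obj (A \<and>\<^sub>\<Gamma> A) Z))"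
    and m_el: "\<lbrakk>v \<in> pmaps (std (k * l)) (std Z); a \<in> car (obj A k); b \<in> car (obj A l)\<rbrakk>
      \<Longrightarrow> m Z (day_el A A Z k l v a b) = mor A (k * l) Z v (p k l a b)"
begin

lemma A_functor: "Gamma_functor A"
  using A by (simp add: Gamma_set_def)

text \<open>On generators the action of \<open>w\<close> is composition with the index map, and
  \<open>m\<close> applies \<open>mor A\<close> to that map, so naturality becomes functoriality of
  \<open>A\<close>.\<close>

lemma m_hom: "Gamma_hom (A \<and>\<^sub>\<Gamma> A) A m"
  unfolding Gamma_hom_def
proof (intro conjI allI ballI)
  note AA = A_functor A_functor
  fix Z
  show "m Z \<in> pmaps (obj (A \<and>\<^sub>\<Gamma> A) Z) (obj A Z)"
  proof (rule pmapsI[OF _ m_extensional])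
    fix q assume "q \<in> car (obj (A \<and>\<^sub>\<Gamma> A) Z)"
    then show "m Z q \<in> car (obj A Z)"
      by (elim day_cases[OF AA])
        (simp add: m_el p_in pmaps_in[OF Gamma_functor_mor[OF A_functor]])
  next
    have v: "(\<lambda>i\<in>{0..0}. 0) \<in> pmaps (std (0 * 0)) (std Z)" by (auto simp: pmaps_def)
    have "m Z (day_el A A Z 0 0 (\<lambda>i\<in>{0..0}. 0) (pt (obj A 0)) (pt (obj A 0))) = pt (obj A Z)"
      using pmaps_pt[OF Gamma_functor_mor[OF A_functor v]]
      by (simp only: m_el[OF v] Gamma_functor_pt[OF A_functor] p_pt)
    then show "m Z (pt (obj (A \<and>\<^sub>\<Gamma> A) Z)) = pt (obj A Z)"
      by (simp only: day_el_pt[OF AA v])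
  qed
  fix Z' w assume w: "w \<in> pmaps (std Z) (std Z')"
  have "m Z' (mor (A \<and>\<^sub>\<Gamma> A) Z Z' w q) = mor A Z Z' w (m Z q)"
    if q: "q \<in> car (obj (A \<and>\<^sub>\<Gamma> A) Z)" for q
    using q
    by (elim day_cases[OF AA])
      (simp add: m_el day_mor_el[OF AA w] std_compose[OF _ w] p_in Gamma_functor_comp[OF A_functor _ w])
  then show "compose (car (obj (A \<and>\<^sub>\<Gamma> A) Z)) (m Z') (mor (A \<and>\<^sub>\<Gamma> A) Z Z' w)
    = compose (car (obj (A \<and>\<^sub>\<Gamma> A) Z)) (mor A Z Z' w) (m Z)"
    by (auto simp: compose_def fun_eq_iff)
qed

lemma S_algebra: "S_algebra A m u"
proof
  note AA = A_functor A_functor and idA = Gamma_hom_id[OF A_functor] and AF = A_functor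
    and AAF = day_functor[OF A_functor A_functor]
  have id_el: "Gamma_id A k a = a" if "a \<in> car (obj A k)" for k a
    using that by (simp add: Gamma_id_def)
  show "Gamma_set A" "Gamma_hom (A \<and>\<^sub>\<Gamma> A) A m" "Gamma_hom \<S> A u"
    by (rule A m_hom u)+
  have u_in: "u k i \<in> car (obj A k)" if "i \<le> k" for k i
    using u that by (auto simp: Gamma_hom_def \<S>_def intro: pmaps_in)
  show "Gamma_comp (\<S> \<and>\<^sub>\<Gamma> A) m (day_map \<S> A A A u (Gamma_id A)) = day_lunit A"
  proof (rule Gamma_comp_eqI)
    fix Z q assume "q \<in> car (obj (\<S> \<and>\<^sub>\<Gamma> A) Z)"
    then obtain k l v i b where *: "v \<in> pmaps (std (k * l)) (std Z)" "i \<in> car (obj \<S> k)"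
      "b \<in> car (obj A l)" "q = day_el \<S> A Z k l v i b" by (rule day_cases[OF S_functor AF])
    have "i \<le> k" using *(2) by (simp add: \<S>_def)
    then show "m Z (day_map \<S> A A A u (Gamma_id A) Z q) = day_lunit A Z q"
      using * by (simp add: day_map_el[OF S_functor AF AF AF u idA] id_el m_el u_in
          p_unit_left day_lunit_el[OF A])
  qed (simp add: day_lunit_def day_lift_extensional)
  show "Gamma_comp (A \<and>\<^sub>\<Gamma> \<S>) m (day_map A \<S> A A (Gamma_id A) u) = day_runit A"
  proof (rule Gamma_comp_eqI)
    fix Z q assume "q \<in> car (obj (A \<and>\<^sub>\<Gamma> \<S>) Z)"
    then obtain k l v a j where *: "v \<in> pmaps (std (k * l)) (std Z)" "a \<in> car (obj A k)"
      "j \<in> car (obj \<S> l)" "q = day_el A \<S> Z k l v a j" by (rule day_cases[OF AF S_functor])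
    have "j \<le> l" using *(3) by (simp add: \<S>_def)
    then show "m Z (day_map A \<S> A A (Gamma_id A) u Z q) = day_runit A Z q"
      using * by (simp add: day_map_el[OF AF S_functor AF AF idA u] id_el m_el u_in
          p_unit_right day_runit_el[OF A])
  qed (simp add: day_runit_def day_lift_extensional)
  show "Gamma_comp ((A \<and>\<^sub>\<Gamma> A) \<and>\<^sub>\<Gamma> A) m (day_map (A \<and>\<^sub>\<Gamma> A) A A A m (Gamma_id A))
      = Gamma_comp ((A \<and>\<^sub>\<Gamma> A) \<and>\<^sub>\<Gamma> A) m
          (Gamma_comp ((A \<and>\<^sub>\<Gamma> A) \<and>\<^sub>\<Gamma> A) (day_map A (A \<and>\<^sub>\<Gamma> A) A A (Gamma_id A) m) (day_assoc A A A))"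
  proof (rule Gamma_comp_cong)
    fix Z x assume x: "x \<in> car (obj ((A \<and>\<^sub>\<Gamma> A) \<and>\<^sub>\<Gamma> A) Z)"
    then obtain r n v q c where v: "v \<in> pmaps (std (r * n)) (std Z)" and q: "q \<in> car (obj (A \<and>\<^sub>\<Gamma> A) r)"
      and c: "c \<in> car (obj A n)" and x_eq: "x = day_el (A \<and>\<^sub>\<Gamma> A) A Z r n v q c"
      by (rule day_cases[OF AAF AF])
    from q obtain k l w a b where w: "w \<in> pmaps (std (k * l)) (std r)"
      and a: "a \<in> car (obj A k)" and b: "b \<in> car (obj A l)" and q_eq: "q = day_el A A r k l w a b"
      by (rule day_cases[OF AA])
    let ?w = "nsmash (k * l) n n w (\<lambda>j\<in>{0..n}. j)"
    let ?e = "day_el A A (l * n) l n (\<lambda>j\<in>{0..l * n}. j) b c"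
    have w': "?w \<in> pmaps (std (k * l * n)) (std (r * n))" by (rule nsmash_pmaps[OF w std_id])
    then have vw: "compose {0..k * (l * n)} v ?w \<in> pmaps (std (k * (l * n))) (std Z)"
      using std_compose[OF _ v, of ?w "k * l * n"] by (simp add: mult.assoc)
    have e: "?e \<in> car (obj (A \<and>\<^sub>\<Gamma> A) (l * n))" by (rule day_el_in[OF AA std_id b c])
    have pab: "p k l a b \<in> car (obj A (k * l))" and pbc: "p l n b c \<in> car (obj A (l * n))"
      using a b c by (simp_all add: p_in)
    have "m Z (day_map (A \<and>\<^sub>\<Gamma> A) A A A m (Gamma_id A) Z x)
      = mor A (r * n) Z v (p r n (mor A (k * l) r w (p k l a b)) c)"
      using v q c w a b pab
      by (simp add: x_eq day_map_el[OF AAF AF AF AF m_hom idA] id_el)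
        (simp add: q_eq m_el pmaps_in[OF Gamma_functor_mor[OF AF]])
    \<comment> \<open>Naturality of \<open>p\<close> with an identity in the second variable pulls
      \<open>w\<close> out; the resulting index map is the one produced by
      \<open>day_assoc\<close>.\<close>
    also have "p r n (mor A (k * l) r w (p k l a b)) c = mor A (k * l * n) (r * n) ?w (p (k * l) n (p k l a b) c)"
      using p_mor[OF w std_id pab c] by (simp add: Gamma_functor_id[OF AF c])
    also have "mor A (r * n) Z v \<dots> = mor A (k * l * n) Z (compose {0..k * l * n} v ?w) (p (k * l) n (p k l a b) c)"
      by (rule Gamma_functor_comp[OF AF w' v p_in[OF pab c]])
    \<comment> \<open>The only use of \<open>p_assoc\<close>. Reassociating the products of numbers
      identifies the two sources of the index map.\<close>
    also have "\<dots> = mor A (k * (l * n)) Z (compose {0..k * (l * n)} v ?w) (p k (l * n) a (p l n b c))"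
      by (simp add: p_assoc[OF a b c] mult.assoc)
    \<comment> \<open>\<open>day_assoc\<close> places \<open>b\<close> and \<open>c\<close> over an
      identity, so the inner \<open>m\<close> evaluates to \<open>p l n b c\<close> itself.\<close>
    also have "\<dots> = m Z (day_map A (A \<and>\<^sub>\<Gamma> A) A A (Gamma_id A) m Z (day_assoc A A A Z x))"
      using a pbc
      by (simp add: x_eq q_eq day_assoc_el[OF AF AF AF v w a b c] id_el m_el[OF vw] m_el[OF std_id b c]
          day_map_el[OF AF AAF AF AF idA m_hom vw a e] Gamma_functor_id[OF AF])
    finally show "m Z (day_map (A \<and>\<^sub>\<Gamma> A) A A A m (Gamma_id A) Z x)
      = m Z (Gamma_comp ((A \<and>\<^sub>\<Gamma> A) \<and>\<^sub>\<Gamma> A) (day_map A (A \<and>\<^sub>\<Gamma> A) A A (Gamma_id A) m) (day_assoc A A A) Z x)"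
      using x by (simp add: Gamma_comp_def compose_eq)
  qed
qed

end

section \<open>The external product of a pointed monad\<close>

lemma is_functor_comp: "\<lbrakk>is_functor C D F; is_functor D E G\<rbrakk> \<Longrightarrow> is_functor C E (G \<circ>\<^sub>F F)"
  unfolding is_functor_def comp_funct_def by simp

section \<open>The skeleton inside the category of small pointed sets\<close>

context set_universe
begin

lemma Ob_iff: "X \<in> Ob (Sets_pt small) \<longleftrightarrow> pt X \<in> car X \<and> small (car X)"
  by (simp add: Sets_pt_def)

lemma smash_Ob:
  assumes X: "X \<in> Ob (Sets_pt small)" and Y: "Y \<in> Ob (Sets_pt small)"
  shows "smash pair X Y \<in> Ob (Sets_pt small)"
proof -
  \<comment> \<open>Written as a small union of images of \<open>car Y\<close>, the carrier is small
    by the closure axioms.\<close>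
  have "car (smash pair X Y) = (\<Union>x\<in>car X. smash_el pair X Y x ` car Y)"
    by (auto simp: smash_def)
  moreover have "small (\<Union>x\<in>car X. smash_el pair X Y x ` car Y)"
    using X Y by (intro small_UN small_image) (simp_all add: Ob_iff)
  ultimately have "small (car (smash pair X Y))" by simp
  then show ?thesis using X Y by (simp add: Ob_iff pt_smash_in)
qed

abbreviation "I \<equiv> fin_incl num"

lemma car_I: "car (obj I k) = num ` {0..k}" and pt_I: "pt (obj I k) = num 0"
  by (simp_all add: fin_incl_def)

lemma I_Ob: "obj I k \<in> Ob (Sets_pt small)"
  by (simp add: Ob_iff car_I pt_I small_finite)

lemma num_in_I: "i \<le> k \<Longrightarrow> num i \<in> car (obj I k)"
  by (simp add: car_I)

lemma I_cases:
  assumes "x \<in> car (obj I k)" obtains i where "i \<le> k" "x = num i"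
  using assms by (auto simp: car_I)

lemma I_mor_num: "i \<le> k \<Longrightarrow> mor I k l f (num i) = num (f i)"
  by (simp add: fin_incl_def inv_f_f[OF inj_num])

lemma I_mor:
  assumes f: "f \<in> pmaps (std k) (std l)"
  shows "mor I k l f \<in> pmaps (obj I k) (obj I l)"
proof (rule pmapsI)
  fix x assume "x \<in> car (obj I k)"
  then show "mor I k l f x \<in> car (obj I l)"
    using pmaps_in[OF f] by (elim I_cases) (simp add: I_mor_num num_in_I)
next
  show "mor I k l f (pt (obj I k)) = pt (obj I l)"
    using pmaps_pt[OF f] by (simp add: pt_I I_mor_num)
qed (simp add: fin_incl_def)

lemma I_functor: "is_functor Gamma_op (Sets_pt small) I"
proof
  fix k l m f g
  show "obj I k \<in> Ob (Sets_pt small)" by (rule I_Ob)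
  show "f \<in> Hom Gamma_op k l \<Longrightarrow> mor I k l f \<in> Hom (Sets_pt small) (obj I k) (obj I l)"
    using I_mor by (simp add: Gamma_op_def Sets_pt_def)
  show "mor I k k (Idt Gamma_op k) = Idt (Sets_pt small) (obj I k)"
    by (auto simp: Gamma_op_def Sets_pt_def fin_incl_def fun_eq_iff inv_f_f[OF inj_num])
  assume "f \<in> Hom Gamma_op k l"
  then have "f i \<le> l" if "i \<le> k" for i
    using that pmaps_in[of f "std k" "std l" i] by (simp add: Gamma_op_def)
  then show "mor I k m (Cmp Gamma_op k l m g f)
      = Cmp (Sets_pt small) (obj I k) (obj I l) (obj I m) (mor I l m g) (mor I k l f)"
    by (auto simp: Gamma_op_def Sets_pt_def fin_incl_def fun_eq_iff compose_def inv_f_f[OF inj_num])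
qed

text \<open>Changing the notion of smallness changes only the objects of \<open>Sets_pt\<close>, so
  a functor to small pointed sets is also one to all pointed sets of the type.\<close>

lemma restr_functor:
  assumes "is_functor (Sets_pt small) (Sets_pt small) U"
  shows "Gamma_functor (restr num U)"
proof -
  have "is_functor Gamma_op (Sets_pt small) (restr num U)"
    unfolding restr_def by (rule is_functor_comp[OF I_functor assms])
  then show ?thesis by (simp add: is_functor_def Sets_pt_def)
qed

lemma inclusion_pmaps:
  assumes "x \<in> car X" "pt Y \<in> car Y"
  shows "(\<lambda>y\<in>car Y. smash_el pair X Y x y) \<in> pmaps Y (smash pair X Y)"
    "(\<lambda>y\<in>car Y. smash_el pair Y X y x) \<in> pmaps Y (smash pair Y X)"
  using assms by (auto intro!: pmapsI simp: smash_el_in)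

lemma swap_el:
  assumes "x \<in> car X" "y \<in> car Y" "pt X \<in> car X" "pt Y \<in> car Y"
  shows "swap pair X Y (smash_el pair X Y x y) = smash_el pair Y X y x"
  unfolding swap_def
  by (rule smash_fun_el[OF inj_pair, where b = "pt (smash pair Y X)"]) (use assms in simp_all)

lemma swap_pmaps:
  assumes "pt X \<in> car X" "pt Y \<in> car Y"
  shows "swap pair X Y \<in> pmaps (smash pair X Y) (smash pair Y X)"
proof (rule pmapsI)
  fix z assume "z \<in> car (smash pair X Y)"
  then show "swap pair X Y z \<in> car (smash pair Y X)"
    by (elim smash_cases) (simp add: swap_el assms smash_el_in)
next
  show "swap pair X Y (pt (smash pair X Y)) = pt (smash pair Y X)"
    using swap_el[of "pt X" X "pt Y" Y] assms by simp
qed (simp add: swap_def smash_fun_def)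

lemma fin_smash_el:
  assumes "i \<le> k" "j \<le> l"
  shows "fin_smash num pair k l (smash_el pair (obj I k) (obj I l) (num i) (num j)) = num (nsm l i j)"
proof -
  have "fin_smash num pair k l (smash_el pair (obj I k) (obj I l) (num i) (num j))
    = num (nsm l (inv num (num i)) (inv num (num j)))"
    unfolding fin_smash_def
    by (rule smash_fun_el[OF inj_pair, where b = "num 0"])
      (use assms in \<open>simp_all add: car_I pt_I inv_f_f[OF inj_num]\<close>)
  then show ?thesis by (simp add: inv_f_f[OF inj_num])
qed

lemma fin_smash_pmaps: "fin_smash num pair k l \<in> pmaps (smash pair (obj I k) (obj I l)) (obj I (k * l))"
proof (rule pmapsI)
  fix z assume "z \<in> car (smash pair (obj I k) (obj I l))"
  then show "fin_smash num pair k l z \<in> car (obj I (k * l))"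
    by (elim smash_cases I_cases) (simp add: fin_smash_el num_in_I nsm_le)
next
  have "pt (smash pair (obj I k) (obj I l)) = smash_el pair (obj I k) (obj I l) (num 0) (num 0)"
    using smash_el_pt(1)[of pair "obj I k" "obj I l" "num 0"] by (simp add: pt_I)
  then show "fin_smash num pair k l (pt (smash pair (obj I k) (obj I l))) = pt (obj I (k * l))"
    using fin_smash_el[of 0 k 0 l] by (simp add: pt_I)
qed (simp add: fin_smash_def smash_fun_def)

end

locale pointed_monad = set_universe small num pair + monad "Sets_pt small" T \<mu> \<epsilon>
  for small :: "'u set \<Rightarrow> bool" and num :: "nat \<Rightarrow> 'u" and pair :: "'u \<times> 'u \<Rightarrow> 'u"
    and T :: "'u endo" and \<mu> \<epsilon> :: "'u pset \<Rightarrow> 'u \<Rightarrow> 'u" +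
  assumes pointed: "pointed_funct small T"
begin

section \<open>The functor and monad laws on elements\<close>

abbreviation "Obs \<equiv> Ob (Sets_pt small)"

lemma pt_in: "X \<in> Obs \<Longrightarrow> pt X \<in> car X"
  by (simp add: Ob_iff)

lemma T_Ob: "X \<in> Obs \<Longrightarrow> obj T X \<in> Obs"
  by (rule is_functor.obj_in[OF endofunctor])

lemma T_mor: "\<lbrakk>X \<in> Obs; Y \<in> Obs; f \<in> pmaps X Y\<rbrakk> \<Longrightarrow> mor T X Y f \<in> pmaps (obj T X) (obj T Y)"
  using is_functor.mor_in[OF endofunctor, of X Y f] by (simp add: Sets_pt_def)

text \<open>The composite is kept as an explicit restricted function, so that \<open>T_cong\<close>
  can rewrite its values on the carrier.\<close>

lemma T_comp:
  assumes "X \<in> Obs" "Y \<in> Obs" "Z \<in> Obs" "f \<in> pmaps X Y" "g \<in> pmaps Y Z" "a \<in> car (obj T X)"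
  shows "mor T Y Z g (mor T X Y f a) = mor T X Z (\<lambda>x\<in>car X. g (f x)) a"
  using is_functor.mor_cmp[OF endofunctor, of X Y Z f g] assms
  by (simp add: Sets_pt_def compose_def)

lemma T_cong:
  "(\<And>x. x \<in> car X \<Longrightarrow> f x = g x) \<Longrightarrow> mor T X Y (\<lambda>x\<in>car X. f x) a = mor T X Y (\<lambda>x\<in>car X. g x) a"
  by (metis restrict_ext)

text \<open>A constant map factors through a one-point set, which the pointed functor
  \<open>T\<close> sends to a one-point set. This makes \<open>iota\<close> well defined where its
  first argument is the base point.\<close>

lemma T_const:
  assumes X: "X \<in> Obs" and Y: "Y \<in> Obs" and a: "a \<in> car (obj T X)"
  shows "mor T X Y (\<lambda>x\<in>car X. pt Y) a = pt (obj T Y)"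
proof -
  define P where "P = \<lparr>car = {pt X}, pt = pt X\<rparr>"
  have P: "P \<in> Obs" by (simp add: P_def Ob_iff small_finite)
  have TP: "car (obj T P) = {pt (obj T P)}"
    using pointed P by (simp add: pointed_funct_def P_def)
  have f: "(\<lambda>x\<in>car X. pt X) \<in> pmaps X P" and g: "(\<lambda>x\<in>car P. pt Y) \<in> pmaps P Y"
    using pt_in[OF X] pt_in[OF Y] by (auto intro!: pmapsI simp: P_def)
  have "mor T X Y (\<lambda>x\<in>car X. pt Y) a = mor T P Y (\<lambda>x\<in>car P. pt Y) (mor T X P (\<lambda>x\<in>car X. pt X) a)"
    unfolding T_comp[OF X P Y f g a] by (rule T_cong) (simp add: P_def)
  also have "mor T X P (\<lambda>x\<in>car X. pt X) a = pt (obj T P)"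
    using pmaps_in[OF T_mor[OF X P f] a] TP by simp
  also have "mor T P Y (\<lambda>x\<in>car P. pt Y) (pt (obj T P)) = pt (obj T Y)"
    by (rule pmaps_pt[OF T_mor[OF P Y g]])
  finally show ?thesis .
qed

lemma mu_pmaps: "X \<in> Obs \<Longrightarrow> \<mu> X \<in> pmaps (obj T (obj T X)) (obj T X)"
  using nat_trans.component[OF mult, of X] by (simp add: Sets_pt_def comp_funct_def)

lemma mu_mor:
  assumes "X \<in> Obs" "Y \<in> Obs" "f \<in> pmaps X Y" "a \<in> car (obj T (obj T X))"
  shows "\<mu> Y (mor T (obj T X) (obj T Y) (mor T X Y f) a) = mor T X Y f (\<mu> X a)"
proof -
  have "compose (car (obj T (obj T X))) (\<mu> Y) (mor T (obj T X) (obj T Y) (mor T X Y f))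
    = compose (car (obj T (obj T X))) (mor T X Y f) (\<mu> X)"
    using nat_trans.naturality[OF mult, of X Y f] assms by (simp add: Sets_pt_def comp_funct_def)
  from fun_cong[OF this, of a] show ?thesis using assms(4) by (simp add: compose_eq)
qed

lemma mu_mu:
  assumes "X \<in> Obs" "a \<in> car (obj T (obj T (obj T X)))"
  shows "\<mu> X (mor T (obj T (obj T X)) (obj T X) (\<mu> X) a) = \<mu> X (\<mu> (obj T X) a)"
  using fun_cong[OF assoc[OF assms(1)], of a] assms(2) by (simp add: Sets_pt_def compose_eq)

lemma eps_pmaps: "X \<in> Obs \<Longrightarrow> \<epsilon> X \<in> pmaps X (obj T X)"
  using nat_trans.component[OF unit, of X] by (simp add: Sets_pt_def id_funct_def)

lemma eps_mor:
  assumes "X \<in> Obs" "Y \<in> Obs" "f \<in> pmaps X Y" "x \<in> car X"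
  shows "mor T X Y f (\<epsilon> X x) = \<epsilon> Y (f x)"
proof -
  have "compose (car X) (\<epsilon> Y) f = compose (car X) (mor T X Y f) (\<epsilon> X)"
    using nat_trans.naturality[OF unit, of X Y f] assms by (simp add: Sets_pt_def id_funct_def)
  from fun_cong[OF this, of x] show ?thesis using assms(4) by (simp add: compose_eq)
qed

lemma mu_eps: "\<lbrakk>X \<in> Obs; a \<in> car (obj T X)\<rbrakk> \<Longrightarrow> \<mu> X (\<epsilon> (obj T X) a) = a"
  using fun_cong[OF unit_left, of X a] by (simp add: Sets_pt_def compose_eq)

lemma mu_T_eps: "\<lbrakk>X \<in> Obs; a \<in> car (obj T X)\<rbrakk> \<Longrightarrow> \<mu> X (mor T X (obj T X) (\<epsilon> X) a) = a"
  using fun_cong[OF unit_right, of X a] by (simp add: Sets_pt_def compose_eq)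

section \<open>Kleisli calculus\<close>

definition bind :: "'u pset \<Rightarrow> 'u pset \<Rightarrow> ('u \<Rightarrow> 'u) \<Rightarrow> 'u \<Rightarrow> 'u" where
  "bind X Y h a = \<mu> Y (mor T X (obj T Y) h a)"

lemma bind_pmaps:
  assumes X: "X \<in> Obs" and Y: "Y \<in> Obs" and h: "h \<in> pmaps X (obj T Y)"
  shows "a \<in> car (obj T X) \<Longrightarrow> bind X Y h a \<in> car (obj T Y)"
    "bind X Y h (pt (obj T X)) = pt (obj T Y)"
  using T_mor[OF X T_Ob[OF Y] h] mu_pmaps[OF Y] by (simp_all add: bind_def pmaps_in pmaps_pt)

lemma bind_cong:
  "(\<And>x. x \<in> car X \<Longrightarrow> f x = g x) \<Longrightarrow> bind X Y (\<lambda>x\<in>car X. f x) a = bind X Y (\<lambda>x\<in>car X. g x) a"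
  unfolding bind_def by (simp cong: T_cong)

lemma bind_T:
  assumes "X \<in> Obs" "Y \<in> Obs" "Z \<in> Obs" "f \<in> pmaps X Y" "h \<in> pmaps Y (obj T Z)" "a \<in> car (obj T X)"
  shows "bind Y Z h (mor T X Y f a) = bind X Z (\<lambda>x\<in>car X. h (f x)) a"
  using assms by (simp add: bind_def T_comp T_Ob)

text \<open>Naturality of \<mu> moves \<open>g\<close> past the multiplication, and functoriality of
  \<open>T\<close> then composes it with \<open>h\<close>.\<close>

lemma T_bind:
  assumes "X \<in> Obs" "Y \<in> Obs" "Z \<in> Obs" "h \<in> pmaps X (obj T Y)" "g \<in> pmaps Y Z" "a \<in> car (obj T X)"
  shows "mor T Y Z g (bind X Y h a) = bind X Z (\<lambda>x\<in>car X. mor T Y Z g (h x)) a"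
  using assms by (simp add: bind_def mu_mor[symmetric] T_comp T_Ob T_mor pmaps_in[OF T_mor])

text \<open>\<open>T_bind\<close>, taken with \<open>h'\<close> as a map into
  \<open>obj T Z\<close>, brings \<open>h'\<close> under the inner extension. This leaves two
  multiplications in a row; associativity of \<mu> turns the inner one into \<open>T\<close> of
  \<mu>, which \<open>T_comp\<close> absorbs into the integrand.\<close>

lemma bind_bind:
  assumes X: "X \<in> Obs" and Y: "Y \<in> Obs" and Z: "Z \<in> Obs"
    and h: "h \<in> pmaps X (obj T Y)" and h': "h' \<in> pmaps Y (obj T Z)" and a: "a \<in> car (obj T X)"
  shows "bind Y Z h' (bind X Y h a) = bind X Z (\<lambda>x\<in>car X. bind Y Z h' (h x)) a"
proof -
  note O = X Y Z T_Ob T_Ob[OF T_Ob]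
  let ?g = "mor T Y (obj T Z) h'"
  have g: "?g \<in> pmaps (obj T Y) (obj T (obj T Z))" by (rule T_mor) (use O h' in auto)
  have gh: "(\<lambda>x\<in>car X. ?g (h x)) \<in> pmaps X (obj T (obj T Z))"
    using pmaps_compose[OF h g pt_in[OF X]] by (simp add: compose_def)
  have "bind Y Z h' (bind X Y h a) = \<mu> Z (\<mu> (obj T Z) (mor T X (obj T (obj T Z)) (\<lambda>x\<in>car X. ?g (h x)) a))"
    using T_bind[OF X Y T_Ob[OF Z] h h' a] by (simp add: bind_def)
  also have "\<dots> = \<mu> Z (mor T (obj T (obj T Z)) (obj T Z) (\<mu> Z)
      (mor T X (obj T (obj T Z)) (\<lambda>x\<in>car X. ?g (h x)) a))"
    by (rule mu_mu[OF Z, symmetric]) (rule pmaps_in[OF T_mor[OF _ _ gh] a], use O in auto)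
  also have "\<dots> = bind X Z (\<lambda>x\<in>car X. bind Y Z h' (h x)) a"
    using T_comp[OF X _ _ gh mu_pmaps[OF Z] a] O by (simp add: bind_def cong: T_cong)
  finally show ?thesis .
qed

lemma bind_eps:
  "\<lbrakk>X \<in> Obs; Y \<in> Obs; h \<in> pmaps X (obj T Y); x \<in> car X\<rbrakk> \<Longrightarrow> bind X Y h (\<epsilon> X x) = h x"
  by (simp add: bind_def eps_mor T_Ob mu_eps pmaps_in)

text \<open>After splitting off \<open>f\<close> by functoriality, this is the unit law for \<mu>
  after \<open>T\<close> of \<epsilon>.\<close>

lemma bind_unit:
  assumes "X \<in> Obs" "Y \<in> Obs" "f \<in> pmaps X Y" "a \<in> car (obj T X)"
  shows "bind X Y (\<lambda>x\<in>car X. \<epsilon> Y (f x)) a = mor T X Y f a"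
  using T_comp[of X Y "obj T Y" f "\<epsilon> Y" a] mu_T_eps[of Y "mor T X Y f a"] assms
  by (simp add: bind_def T_Ob eps_pmaps pmaps_in[OF T_mor])

section \<open>The assembly map on elements\<close>

lemma iota_el:
  assumes X: "X \<in> Obs" and Y: "Y \<in> Obs" and x: "x \<in> car X" and b: "b \<in> car (obj T Y)"
  shows "iota pair T X Y (smash_el pair X (obj T Y) x b)
    = mor T Y (smash pair X Y) (\<lambda>y\<in>car Y. smash_el pair X Y x y) b"
  unfolding iota_def
proof (rule smash_fun_el[OF inj_pair x b, where b = "pt (obj T (smash pair X Y))"])
  note XY = smash_Ob[OF X Y]
  fix b assume "b \<in> car (obj T Y)"
  \<comment> \<open>For \<open>x\<close> the base point the inclusion of \<open>Y\<close> is
    constant, so \<open>T_const\<close> gives the value.\<close>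
  then show "mor T Y (smash pair X Y) (\<lambda>y\<in>car Y. smash_el pair X Y (pt X) y) b = pt (obj T (smash pair X Y))"
    using T_const[OF Y XY] by simp
next
  fix x assume "x \<in> car X"
  then show "mor T Y (smash pair X Y) (\<lambda>y\<in>car Y. smash_el pair X Y x y) (pt (obj T Y)) = pt (obj T (smash pair X Y))"
    by (intro pmaps_pt[OF T_mor] Y smash_Ob X inclusion_pmaps pt_in)
qed (simp_all add: X Y T_Ob pt_in)

lemma iota_pmaps:
  assumes X: "X \<in> Obs" and Y: "Y \<in> Obs"
  shows "iota pair T X Y \<in> pmaps (smash pair X (obj T Y)) (obj T (smash pair X Y))"
proof (rule pmapsI)
  fix z assume "z \<in> car (smash pair X (obj T Y))"
  then show "iota pair T X Y z \<in> car (obj T (smash pair X Y))"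
    by (elim smash_cases)
      (simp add: iota_el X Y pmaps_in[OF T_mor] smash_Ob inclusion_pmaps pt_in)
next
  show "iota pair T X Y (pt (smash pair X (obj T Y))) = pt (obj T (smash pair X Y))"
    using iota_el[OF X Y pt_in[OF X] pt_in[OF T_Ob[OF Y]]] T_const[OF Y smash_Ob[OF X Y] pt_in[OF T_Ob[OF Y]]]
    by simp
qed (simp add: iota_def smash_fun_def)

lemma alpha_el:
  assumes X: "X \<in> Obs" and Y: "Y \<in> Obs" and a: "a \<in> car (obj T X)" and b: "b \<in> car (obj T Y)"
  shows "alpha pair T T X Y (smash_el (\<lambda>z. z) (obj T X) (obj T Y) a b)
    = mor T X (obj T (smash pair X Y))
        (\<lambda>x\<in>car X. mor T Y (smash pair X Y) (\<lambda>y\<in>car Y. smash_el pair X Y x y) b) a"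
proof -
  note O = X Y T_Ob smash_Ob pt_in
  let ?\<beta> = "\<lambda>x\<in>car X. smash_el pair (obj T Y) X b x"
  have \<beta>: "?\<beta> \<in> pmaps X (smash pair (obj T Y) X)" by (rule inclusion_pmaps) (use O b in auto)
  have \<beta>': "(\<lambda>x\<in>car X. smash_el pair X (obj T Y) x b) \<in> pmaps X (smash pair X (obj T Y))"
    by (rule inclusion_pmaps) (use O b in auto)
  have "alpha pair T T X Y (smash_el (\<lambda>z. z) (obj T X) (obj T Y) a b)
    = mor T (smash pair X (obj T Y)) (obj T (smash pair X Y)) (iota pair T X Y)
       (mor T (smash pair (obj T Y) X) (smash pair X (obj T Y)) (swap pair (obj T Y) X)
         (iota pair T (obj T Y) X (smash_el pair (obj T Y) (obj T X) b a)))"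
    unfolding alpha_def by (rule smash_fun_el) (use O a b in simp_all)
  also have "iota pair T (obj T Y) X (smash_el pair (obj T Y) (obj T X) b a)
    = mor T X (smash pair (obj T Y) X) ?\<beta> a"
    by (rule iota_el) (use O a b in auto)
  also have "mor T (smash pair (obj T Y) X) (smash pair X (obj T Y)) (swap pair (obj T Y) X) \<dots>
    = mor T X (smash pair X (obj T Y)) (\<lambda>x\<in>car X. swap pair (obj T Y) X (?\<beta> x)) a"
    by (rule T_comp[OF _ _ _ \<beta> swap_pmaps a]) (use O in auto)
  also have "\<dots> = mor T X (smash pair X (obj T Y)) (\<lambda>x\<in>car X. smash_el pair X (obj T Y) x b) a"
    by (rule T_cong) (use O b in \<open>simp add: swap_el\<close>)
  also have "mor T (smash pair X (obj T Y)) (obj T (smash pair X Y)) (iota pair T X Y) \<dots>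
    = mor T X (obj T (smash pair X Y))
       (\<lambda>x\<in>car X. iota pair T X Y ((\<lambda>x\<in>car X. smash_el pair X (obj T Y) x b) x)) a"
    by (rule T_comp[OF _ _ _ \<beta>' iota_pmaps a]) (use O in auto)
  also have "\<dots> = mor T X (obj T (smash pair X Y))
      (\<lambda>x\<in>car X. mor T Y (smash pair X Y) (\<lambda>y\<in>car Y. smash_el pair X Y x y) b) a"
    by (rule T_cong) (use O b in \<open>simp add: iota_el\<close>)
  finally show ?thesis .
qed

section \<open>The external product of the restricted monad\<close>

abbreviation "A \<equiv> restr num T"

lemma obj_A: "obj A k = obj T (obj I k)"
  and mor_A: "mor A k l f = mor T (obj I k) (obj I l) (mor I k l f)"
  by (simp_all add: restr_def comp_funct_def)

lemma A_Gamma_set: "Gamma_set A"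
  using restr_functor[OF endofunctor] pointed I_Ob[of 0]
  by (simp add: Gamma_set_def pointed_funct_def obj_A car_I pt_I)

lemma A_functor: "Gamma_functor A"
  using A_Gamma_set by (simp add: Gamma_set_def)

text \<open>\<open>row k l b\<close> is \<open>x \<mapsto> A(x \<and> -)(b)\<close>.\<close>

definition row :: "nat \<Rightarrow> nat \<Rightarrow> 'u \<Rightarrow> 'u \<Rightarrow> 'u" where
  "row k l b = (\<lambda>x\<in>car (obj I k). mor A l (k * l) (\<lambda>j\<in>{0..l}. nsm l (inv num x) j) b)"

text \<open>The assembly map in skeleton coordinates, kept apart from \<open>ext_prod\<close>
  because \<open>assembly\<close> is the lift of this family and \<mu> is applied only after the
  lift.\<close>

definition ext_alpha :: "nat \<Rightarrow> nat \<Rightarrow> 'u \<Rightarrow> 'u \<Rightarrow> 'u" where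
  "ext_alpha k l a b = mor T (obj I k) (obj A (k * l)) (row k l b) a"

definition ext_prod :: "nat \<Rightarrow> nat \<Rightarrow> 'u \<Rightarrow> 'u \<Rightarrow> 'u" where
  "ext_prod k l a b = bind (obj I k) (obj I (k * l)) (row k l b) a"

lemma row_num: "i \<le> k \<Longrightarrow> row k l b (num i) = mor A l (k * l) (\<lambda>j\<in>{0..l}. nsm l i j) b"
  by (simp add: row_def num_in_I inv_f_f[OF inj_num])

text \<open>Needed before \<open>T\<close> can be applied to \<open>row\<close>. At the base point
  the row inclusion is constant, so its value is given by \<open>Gamma_set_const\<close>.\<close>

lemma row_pmaps:
  assumes b: "b \<in> car (obj A l)"
  shows "row k l b \<in> pmaps (obj I k) (obj A (k * l))"
proof (rule pmapsI)
  fix x assume "x \<in> car (obj I k)"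
  then show "row k l b x \<in> car (obj A (k * l))"
    by (elim I_cases) (simp add: row_num pmaps_in[OF Gamma_functor_mor[OF A_functor] b] nsm_pmaps)
next
  have "(\<lambda>j\<in>{0..l}. nsm l 0 j) = (\<lambda>j\<in>{0..l}. 0)" by (simp add: fun_eq_iff)
  then show "row k l b (pt (obj I k)) = pt (obj A (k * l))"
    using row_num[of 0 k l b] Gamma_set_const[OF A_Gamma_set b] by (simp only: pt_I le0)
qed (simp add: row_def)

lemma row_mor:
  assumes f: "f \<in> pmaps (std k) (std k')" and g: "g \<in> pmaps (std l) (std l')"
    and b: "b \<in> car (obj A l)" and "x \<in> car (obj I k)"
  shows "row k' l' (mor A l l' g b) (mor I k k' f x)
    = mor A (k * l) (k' * l') (nsmash k l l' f g) (row k l b x)"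
proof -
  from assms(4) obtain i where i: "i \<le> k" "x = num i" by (rule I_cases)
  have fi: "f i \<le> k'" using pmaps_in[OF f, of i] i by simp
  have "row k' l' (mor A l l' g b) (mor I k k' f x)
    = mor A l (k' * l') (compose {0..l} (\<lambda>j\<in>{0..l'}. nsm l' (f i) j) g) b"
    using i fi Gamma_functor_comp[OF A_functor g nsm_pmaps(1)[OF fi] b] by (simp add: I_mor_num row_num)
  also have "\<dots> = mor A (k * l) (k' * l') (nsmash k l l' f g) (row k l b x)"
    using Gamma_functor_comp[OF A_functor nsm_pmaps(1)[OF i(1)] nsmash_pmaps[OF f g] b]
      nsmash_nsm_row[OF f g i(1)] by (simp add: row_num i)
  finally show ?thesis .
qed

lemma ext_prod_mu: "ext_prod k l a b = \<mu> (obj I (k * l)) (ext_alpha k l a b)"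
  by (simp add: ext_prod_def ext_alpha_def bind_def obj_A)

text \<open>This composite is the restriction of \<open>T\<close> composed with itself.\<close>

lemma TA_functor: "Gamma_functor (T \<circ>\<^sub>F A)"
  using restr_functor[OF is_functor_comp[OF endofunctor endofunctor]]
  by (simp add: restr_def comp_funct_def)

lemma obj_TA: "obj (T \<circ>\<^sub>F A) k = obj T (obj A k)"
  and mor_TA: "mor (T \<circ>\<^sub>F A) k l f = mor T (obj A k) (obj A l) (mor A k l f)"
  by (simp_all add: comp_funct_def)

lemma A_Ob: "obj A k \<in> Obs"
  by (simp add: obj_A T_Ob I_Ob)

lemma ext_alpha_in:
  "\<lbrakk>a \<in> car (obj A k); b \<in> car (obj A l)\<rbrakk> \<Longrightarrow> ext_alpha k l a b \<in> car (obj (T \<circ>\<^sub>F A) (k * l))"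
  unfolding ext_alpha_def obj_TA
  by (rule pmaps_in[OF T_mor[OF I_Ob A_Ob row_pmaps]]) (simp_all add: obj_A)

lemma ext_alpha_pt:
  "b \<in> car (obj A l) \<Longrightarrow> ext_alpha k l (pt (obj A k)) b = pt (obj (T \<circ>\<^sub>F A) (k * l))"
  unfolding ext_alpha_def obj_TA
  using pmaps_pt[OF T_mor[OF I_Ob A_Ob row_pmaps]] by (simp add: obj_A)

text \<open>Functoriality of \<open>T\<close> collects all maps into a single integrand on
  \<open>obj I k\<close>, where the claim is \<open>row_mor\<close> at each point.\<close>

lemma ext_alpha_mor:
  assumes f: "f \<in> pmaps (std k) (std k')" and g: "g \<in> pmaps (std l) (std l')"
    and a: "a \<in> car (obj A k)" and b: "b \<in> car (obj A l)"
  shows "ext_alpha k' l' (mor A k k' f a) (mor A l l' g b)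
    = mor (T \<circ>\<^sub>F A) (k * l) (k' * l') (nsmash k l l' f g) (ext_alpha k l a b)"
proof -
  have a': "a \<in> car (obj T (obj I k))" using a by (simp add: obj_A)
  have gb: "mor A l l' g b \<in> car (obj A l')" by (rule pmaps_in[OF Gamma_functor_mor[OF A_functor g] b])
  have "ext_alpha k' l' (mor A k k' f a) (mor A l l' g b)
    = mor T (obj I k) (obj A (k' * l')) (\<lambda>x\<in>car (obj I k). row k' l' (mor A l l' g b) (mor I k k' f x)) a"
    unfolding ext_alpha_def mor_A[of k]
    by (rule T_comp[OF I_Ob I_Ob A_Ob I_mor[OF f] row_pmaps[OF gb] a'])
  also have "\<dots> = mor T (obj I k) (obj A (k' * l'))
      (\<lambda>x\<in>car (obj I k). mor A (k * l) (k' * l') (nsmash k l l' f g) (row k l b x)) a"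
    by (rule T_cong) (rule row_mor[OF f g b])
  also have "\<dots> = mor (T \<circ>\<^sub>F A) (k * l) (k' * l') (nsmash k l l' f g) (ext_alpha k l a b)"
    unfolding ext_alpha_def mor_TA
    by (rule T_comp[OF I_Ob A_Ob A_Ob row_pmaps[OF b] Gamma_functor_mor[OF A_functor nsmash_pmaps[OF f g]] a',
          symmetric])
  finally show ?thesis .
qed

lemma mu_TA:
  assumes v: "v \<in> pmaps (std k) (std Z)" and z: "z \<in> car (obj (T \<circ>\<^sub>F A) k)"
  shows "\<mu> (obj I Z) (mor (T \<circ>\<^sub>F A) k Z v z) = mor A k Z v (\<mu> (obj I k) z)"
  using mu_mor[OF I_Ob I_Ob I_mor[OF v]] z by (simp add: mor_TA obj_TA mor_A obj_A)

lemma ext_prod_assoc: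
  assumes a: "a \<in> car (obj A k)" and b: "b \<in> car (obj A l)" and c: "c \<in> car (obj A n)"
  shows "ext_prod (k * l) n (ext_prod k l a b) c = ext_prod k (l * n) a (ext_prod l n b c)"
proof -
  \<comment> \<open>After \<open>bind_bind\<close>, associativity is an equality of integrands. At x
    = \<open>num i\<close>, \<open>row k l b x\<close> is the image of \<open>b\<close> under the
    inclusion of row \<open>i\<close>, so \<open>bind_T\<close> turns the left side into an
    extension over the points of \<open>obj I l\<close>.\<close>
  have rows: "bind (obj I (k * l)) (obj I (k * l * n)) (row (k * l) n c) (row k l b x)
    = row k (l * n) (ext_prod l n b c) x" if x: "x \<in> car (obj I k)" for x
  proof -
    from x obtain i where i: "i \<le> k" "x = num i" by (rule I_cases)
    let ?i = "\<lambda>j\<in>{0..l}. nsm l i j" and ?i' = "\<lambda>j\<in>{0..l * n}. nsm (l * n) i j"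
    have "bind (obj I (k * l)) (obj I (k * l * n)) (row (k * l) n c) (row k l b x)
      = bind (obj I l) (obj I (k * l * n)) (\<lambda>y\<in>car (obj I l). row (k * l) n c (mor I l (k * l) ?i y)) b"
      using bind_T[OF I_Ob I_Ob I_Ob I_mor[OF nsm_pmaps(1)[OF i(1)]]] row_pmaps[OF c] b
      by (simp add: i row_num mor_A[of l] obj_A)
    also have "\<dots> = bind (obj I l) (obj I (k * (l * n)))
        (\<lambda>y\<in>car (obj I l). mor A (l * n) (k * (l * n)) ?i' (row l n c y)) b"
      unfolding mult.assoc[of k l n]
    proof (rule bind_cong)
      fix y assume "y \<in> car (obj I l)"
      then obtain j where j: "j \<le> l" "y = num j" by (rule I_cases)
      have "row (k * l) n c (mor I l (k * l) ?i y) = mor A n (k * l * n) (\<lambda>h\<in>{0..n}. nsm n (nsm l i j) h) c"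
        using i j by (simp add: I_mor_num row_num nsm_le)
      also have "(\<lambda>h\<in>{0..n}. nsm n (nsm l i j) h) = compose {0..n} ?i' (\<lambda>h\<in>{0..n}. nsm n j h)"
        using j by (auto simp: compose_def fun_eq_iff nsm_assoc nsm_le)
      also have "mor A n (k * l * n) \<dots> c = mor A (l * n) (k * (l * n)) ?i' (row l n c y)"
        using Gamma_functor_comp[OF A_functor nsm_pmaps(1)[OF j(1)] nsm_pmaps(1)[OF i(1)] c]
        by (simp add: j row_num mult.assoc)
      finally show "row (k * l) n c (mor I l (k * l) ?i y) = mor A (l * n) (k * (l * n)) ?i' (row l n c y)" .
    qed
    \<comment> \<open>The inclusion at \<open>i\<close> does not depend on \<open>y\<close>, so
      \<open>T_bind\<close> takes it out of the extension, leaving the product of \<open>b\<close>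
      and \<open>c\<close>.\<close>
    also have "\<dots> = mor A (l * n) (k * (l * n)) ?i' (ext_prod l n b c)"
      unfolding ext_prod_def mor_A[of "l * n"]
      by (rule T_bind[OF I_Ob I_Ob I_Ob _ I_mor[OF nsm_pmaps(1)[OF i(1)]], symmetric])
        (use row_pmaps[OF c] b in \<open>simp_all add: obj_A\<close>)
    also have "\<dots> = row k (l * n) (ext_prod l n b c) x"
      by (simp add: i row_num)
    finally show ?thesis .
  qed
  have "ext_prod (k * l) n (ext_prod k l a b) c = bind (obj I k) (obj I (k * l * n))
      (\<lambda>x\<in>car (obj I k). bind (obj I (k * l)) (obj I (k * l * n)) (row (k * l) n c) (row k l b x)) a"
    unfolding ext_prod_def
    by (rule bind_bind[OF I_Ob I_Ob I_Ob]) (use row_pmaps a b c in \<open>simp_all add: obj_A\<close>)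
  also have "\<dots> = bind (obj I k) (obj I (k * l * n)) (\<lambda>x\<in>car (obj I k). row k (l * n) (ext_prod l n b c) x) a"
    by (rule bind_cong) (rule rows)
  also have "(\<lambda>x\<in>car (obj I k). row k (l * n) (ext_prod l n b c) x) = row k (l * n) (ext_prod l n b c)"
    by (simp add: row_def fun_eq_iff)
  finally show ?thesis by (simp add: ext_prod_def mult.assoc)
qed

lemma unit_num: "i \<le> k \<Longrightarrow> restr_unit num \<epsilon> k i = \<epsilon> (obj I k) (num i)"
  by (simp add: restr_unit_def)

lemma unit_in: "i \<le> k \<Longrightarrow> restr_unit num \<epsilon> k i \<in> car (obj A k)"
  by (simp add: unit_num obj_A pmaps_in[OF eps_pmaps] I_Ob num_in_I)

lemma unit_hom: "Gamma_hom \<S> A (restr_unit num \<epsilon>)"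
  unfolding Gamma_hom_def
proof (intro conjI allI ballI)
  fix k
  show "restr_unit num \<epsilon> k \<in> pmaps (obj \<S> k) (obj A k)"
  proof (rule pmapsI)
    show "restr_unit num \<epsilon> k (pt (obj \<S> k)) = pt (obj A k)"
      using pmaps_pt[OF eps_pmaps[OF I_Ob[of k]]] by (simp add: \<S>_def unit_num obj_A pt_I)
  next
    show "restr_unit num \<epsilon> k \<in> extensional (car (obj \<S> k))"
      by (simp add: \<S>_def restr_unit_def[of num \<epsilon> k])
  qed (simp add: \<S>_def unit_in)
  fix l f assume f: "f \<in> pmaps (std k) (std l)"
  have "restr_unit num \<epsilon> l (f i) = mor A k l f (restr_unit num \<epsilon> k i)" if "i \<le> k" for i
    using that pmaps_in[OF f, of i] eps_mor[OF I_Ob I_Ob I_mor[OF f] num_in_I[OF that]]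
    by (simp add: unit_num mor_A I_mor_num)
  then show "compose (car (obj \<S> k)) (restr_unit num \<epsilon> l) (mor \<S> k l f)
    = compose (car (obj \<S> k)) (mor A k l f) (restr_unit num \<epsilon> k)"
    by (auto simp: \<S>_def compose_def fun_eq_iff)
qed

lemma ext_prod_unit_left:
  "\<lbrakk>i \<le> k; b \<in> car (obj A l)\<rbrakk>
    \<Longrightarrow> ext_prod k l (restr_unit num \<epsilon> k i) b = mor A l (k * l) (\<lambda>j\<in>{0..l}. nsm l i j) b"
  using row_pmaps[of b l k] bind_eps[OF I_Ob I_Ob, of "row k l b" k "k * l" "num i"]
  by (simp add: ext_prod_def unit_num num_in_I obj_A row_num)

lemma ext_prod_unit_right:
  assumes a: "a \<in> car (obj A k)" and j: "j \<le> l"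
  shows "ext_prod k l a (restr_unit num \<epsilon> l j) = mor A k (k * l) (\<lambda>i\<in>{0..k}. nsm l i j) a"
proof -
  let ?f = "\<lambda>i\<in>{0..k}. nsm l i j"
  have "row k l (restr_unit num \<epsilon> l j) = (\<lambda>x\<in>car (obj I k). \<epsilon> (obj I (k * l)) (mor I k (k * l) ?f x))"
  proof (rule extensionalityI)
    fix x assume "x \<in> car (obj I k)"
    then obtain i where i: "i \<le> k" "x = num i" by (rule I_cases)
    show "row k l (restr_unit num \<epsilon> l j) x
      = (\<lambda>x\<in>car (obj I k). \<epsilon> (obj I (k * l)) (mor I k (k * l) ?f x)) x"
      using eps_mor[OF I_Ob I_Ob I_mor[OF nsm_pmaps(1)[OF i(1)]] num_in_I[OF j]] i j
      by (simp add: row_num unit_num mor_A I_mor_num num_in_I)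
  qed (simp_all add: row_def)
  then show ?thesis
    using bind_unit[OF I_Ob I_Ob I_mor[OF nsm_pmaps(2)[OF j]]] a
    by (simp add: ext_prod_def obj_A mor_A)
qed

text \<open>Translates \<open>alpha\<close>, which uses the encoded smash product, to the numbered
  one by pushing \<open>fin_smash\<close> under the outer \<open>T\<close>.\<close>

lemma assembly_family:
  assumes a: "a \<in> car (obj A k)" and b: "b \<in> car (obj A l)"
  shows "mor (T \<circ>\<^sub>F T) (smash pair (obj I k) (obj I l)) (obj I (k * l)) (fin_smash num pair k l)
      (alpha pair T T (obj I k) (obj I l) (smash_el (\<lambda>z. z) (obj A k) (obj A l) a b))
    = ext_alpha k l a b"
proof -
  let ?X = "obj I k" and ?Y = "obj I l" and ?Z = "obj I (k * l)" and ?fs = "fin_smash num pair k l"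
  let ?W = "smash pair ?X ?Y"
  let ?d = "\<lambda>x. \<lambda>y\<in>car ?Y. smash_el pair ?X ?Y x y"
  have a': "a \<in> car (obj T ?X)" and b': "b \<in> car (obj T ?Y)" using a b by (simp_all add: obj_A)
  have W: "?W \<in> Obs" by (intro smash_Ob I_Ob)
  have d: "?d x \<in> pmaps ?Y ?W" if "x \<in> car ?X" for x
    by (intro inclusion_pmaps that pt_in I_Ob)
  have h: "(\<lambda>x\<in>car ?X. mor T ?Y ?W (?d x) b) \<in> pmaps ?X (obj T ?W)"
  proof (rule pmapsI)
    \<comment> \<open>The inclusion at the base point is constant; rewriting it makes
      \<open>T_const\<close> applicable.\<close>
    have "mor T ?Y ?W (?d (pt ?X)) b = mor T ?Y ?W (\<lambda>y\<in>car ?Y. pt ?W) b"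
      by (rule T_cong) simp
    then show "(\<lambda>x\<in>car ?X. mor T ?Y ?W (?d x) b) (pt ?X) = pt (obj T ?W)"
      by (simp only: T_const[OF I_Ob W b'] pt_in[OF I_Ob] restrict_apply if_True)
  qed (auto intro: pmaps_in[OF T_mor[OF I_Ob W d] b'])
  have "mor (T \<circ>\<^sub>F T) ?W ?Z ?fs (alpha pair T T ?X ?Y (smash_el (\<lambda>z. z) (obj A k) (obj A l) a b))
    = mor T (obj T ?W) (obj T ?Z) (mor T ?W ?Z ?fs) (mor T ?X (obj T ?W) (\<lambda>x\<in>car ?X. mor T ?Y ?W (?d x) b) a)"
    unfolding obj_A alpha_el[OF I_Ob I_Ob a' b'] by (simp add: comp_funct_def)
  also have "\<dots> = mor T ?X (obj T ?Z)
      (\<lambda>x\<in>car ?X. mor T ?W ?Z ?fs ((\<lambda>x\<in>car ?X. mor T ?Y ?W (?d x) b) x)) a"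
    by (rule T_comp[OF I_Ob T_Ob[OF W] T_Ob[OF I_Ob] h T_mor[OF W I_Ob fin_smash_pmaps] a'])
  also have "\<dots> = mor T ?X (obj T ?Z) (\<lambda>x\<in>car ?X. mor A l (k * l) (\<lambda>j\<in>{0..l}. nsm l (inv num x) j) b) a"
  proof (rule T_cong)
    fix x assume x: "x \<in> car ?X"
    then obtain i where i: "i \<le> k" "x = num i" by (rule I_cases)
    have "mor T ?W ?Z ?fs ((\<lambda>x\<in>car ?X. mor T ?Y ?W (?d x) b) x)
      = mor T ?Y ?Z (\<lambda>y\<in>car ?Y. ?fs (?d x y)) b"
      using T_comp[OF I_Ob W I_Ob d[OF x] fin_smash_pmaps b'] x by simp
    also have "(\<lambda>y\<in>car ?Y. ?fs (?d x y)) = mor I l (k * l) (\<lambda>j\<in>{0..l}. nsm l (inv num x) j)"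
    proof (rule extensionalityI)
      fix y assume "y \<in> car ?Y"
      then show "(\<lambda>y\<in>car ?Y. ?fs (?d x y)) y = mor I l (k * l) (\<lambda>j\<in>{0..l}. nsm l (inv num x) j) y"
        using i by (elim I_cases) (simp add: num_in_I fin_smash_el I_mor_num inv_f_f[OF inj_num])
    qed (simp_all add: fin_incl_def)
    finally show "mor T ?W ?Z ?fs ((\<lambda>x\<in>car ?X. mor T ?Y ?W (?d x) b) x)
      = mor A l (k * l) (\<lambda>j\<in>{0..l}. nsm l (inv num x) j) b" unfolding mor_A .
  qed
  finally show ?thesis by (simp add: ext_alpha_def row_def obj_A)
qed

lemma assembly_el:
  assumes v: "v \<in> pmaps (std (k * l)) (std Z)" and a: "a \<in> car (obj A k)" and b: "b \<in> car (obj A l)"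
  shows "assembly num pair T T Z (day_el A A Z k l v a b) = mor (T \<circ>\<^sub>F A) (k * l) Z v (ext_alpha k l a b)"
  unfolding assembly_def
proof (rule day_lift_el[OF A_functor A_functor TA_functor v a b])
  fix k l a b assume ab: "a \<in> car (obj A k)" "b \<in> car (obj A l)"
  show "(let X = obj I k; Y = obj I l in compose (car (obj T X \<and>\<^sub>* obj T Y))
          (mor (T \<circ>\<^sub>F T) (smash pair X Y) (obj I (k * l)) (fin_smash num pair k l))
          (alpha pair T T X Y)) (smash_el (\<lambda>z. z) (obj A k) (obj A l) a b) = ext_alpha k l a b"
    using assembly_family[OF ab] smash_el_in[OF ab, of "\<lambda>z. z"] by (simp add: Let_def compose_eq obj_A)
qed (fact ext_alpha_in ext_alpha_pt ext_alpha_mor)+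

text \<open>Naturality of \<open>ext_prod\<close> is that of \<open>ext_alpha\<close> followed by
  that of \<mu> (\<open>mu_TA\<close>). The same \<open>mu_TA\<close> evaluates the multiplication
  on a generator, because it lets \<mu> pass the index map \<open>v\<close>.\<close>

sublocale external_product A ext_prod "restr_unit num \<epsilon>" "restr_mult num pair T \<mu>"
proof
  show "Gamma_set A" by (rule A_Gamma_set)
next
  fix k l a b assume "a \<in> car (obj A k)" "b \<in> car (obj A l)"
  then show "ext_prod k l a b \<in> car (obj A (k * l))"
    unfolding ext_prod_def using bind_pmaps(1)[OF I_Ob I_Ob, of _ k "k * l"] row_pmaps by (simp add: obj_A)
next
  fix k l b assume "b \<in> car (obj A l)"
  then show "ext_prod k l (pt (obj A k)) b = pt (obj A (k * l))"
    unfolding ext_prod_def using bind_pmaps(2)[OF I_Ob I_Ob, of _ k "k * l"] row_pmaps by (simp add: obj_A)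
next
  fix f k k' g l l' a b
  assume *: "f \<in> pmaps (std k) (std k')" "g \<in> pmaps (std l) (std l')" "a \<in> car (obj A k)" "b \<in> car (obj A l)"
  show "ext_prod k' l' (mor A k k' f a) (mor A l l' g b)
    = mor A (k * l) (k' * l') (nsmash k l l' f g) (ext_prod k l a b)"
    by (simp add: ext_prod_mu ext_alpha_mor[OF *] mu_TA[OF nsmash_pmaps[OF *(1,2)] ext_alpha_in[OF *(3,4)]])
next
  fix Z show "restr_mult num pair T \<mu> Z \<in> extensional (car (obj (A \<and>\<^sub>\<Gamma> A) Z))"
    by (simp add: restr_mult_def Gamma_comp_def)
next
  fix v k l Z a b
  assume *: "v \<in> pmaps (std (k * l)) (std Z)" "a \<in> car (obj A k)" "b \<in> car (obj A l)"
  show "restr_mult num pair T \<mu> Z (day_el A A Z k l v a b) = mor A (k * l) Z v (ext_prod k l a b)"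
    using day_el_in[OF A_functor A_functor *]
    by (simp add: restr_mult_def Gamma_comp_def compose_eq assembly_el[OF *] ext_prod_mu
        mu_TA[OF *(1) ext_alpha_in[OF *(2,3)]])
qed (fact ext_prod_assoc unit_hom ext_prod_unit_left ext_prod_unit_right)+

end

theorem proposition7p3:
  fixes small :: "'u set \<Rightarrow> bool" and num :: "nat \<Rightarrow> 'u" and pair :: "'u \<times> 'u \<Rightarrow> 'u"
    and \<Sigma> :: "'u endo" and \<mu> \<epsilon> :: "'u pset \<Rightarrow> 'u \<Rightarrow> 'u"
  assumes "set_universe small num pair"
    and "monad (Sets_pt small) \<Sigma> \<mu> \<epsilon>"
    and "pointed_funct small \<Sigma>"
    and "algebraic small \<Sigma>"
  shows "S_algebra (restr num \<Sigma>) (restr_mult num pair \<Sigma> \<mu>) (restr_unit num \<epsilon>)"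
proof -
  interpret pointed_monad small num pair \<Sigma> \<mu> \<epsilon>
    using assms(1-3) by (simp add: pointed_monad_def pointed_monad_axioms_def)
  show ?thesis by (rule S_algebra)
qed

end
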